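(* Consider a combinatorial problem with ground set $\mathcal{U}$ and feasible family $\mathcal{F}$. If there is a polynomial-time $\alpha$-approximation algorithm ($\alpha\ge1$) for the min-sum problem $\min_{S\in\mathcal{F}}\sum_{e\in S}v_e$ (for arbitrary nonnegative values), then there is a polynomial-time $\alpha$-approximation algorithm for the top-$\ell$ minimization problem $\min_{S\in\mathcal{F}}\mathrm{top}_\ell(\boldsymbol{v}[S])$.
   Context: $\mathrm{top}_\ell(x)$ is the sum of the $\ell$ largest absolute values of entries of $x$; $\boldsymbol{v}[S]$ has entries $v_e\mathbf{1}[e\in S]$, $\boldsymbol{v}\ge0$. *)

theory Defs
  imports Complex_Main "HOL-Library.Log_Nat"
begin

section \<open>Random access machines with logarithmic cost\<close>

text \<open>
  Polynomial time is measured on a random access machine under the logarithmic cost criterion,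
  which is polynomially equivalent to Turing machines. Memory cells hold natural numbers of
  unbounded size, each operation is charged for the binary length of all numbers and addresses it
  handles, and nested \<open>Mem\<close> gives indirect addressing. Programs are written with
  structured control flow instead of jumps. The extra one in \<open>len\<close> accounts for a
  delimiter and makes every operation cost something.
\<close>

definition len :: "nat \<Rightarrow> nat" where
  "len n = Suc (floorlog 2 n)"

datatype exp =
    Const nat
  | Mem exp
  | Add exp exp
  | Sub exp exp
  | Mul exp exp
  | Div exp exp

datatype com =
    Skip
  | Store exp exp
  | Seq com com
  | If_Pos exp com com
  | While_Pos exp com

type_synonym memory = "nat \<Rightarrow> nat"

fun eval_exp :: "exp \<Rightarrow> memory \<Rightarrow> nat" where
  "eval_exp (Const n) s = n"
| "eval_exp (Mem a) s = s (eval_exp a s)"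
| "eval_exp (Add a b) s = eval_exp a s + eval_exp b s"
| "eval_exp (Sub a b) s = eval_exp a s - eval_exp b s"
| "eval_exp (Mul a b) s = eval_exp a s * eval_exp b s"
| "eval_exp (Div a b) s = eval_exp a s div eval_exp b s"

fun exp_time :: "exp \<Rightarrow> memory \<Rightarrow> nat" where
  "exp_time (Const n) s = len n"
| "exp_time (Mem a) s = exp_time a s + len (eval_exp a s) + len (s (eval_exp a s))"
| "exp_time (Add a b) s = exp_time a s + exp_time b s + len (eval_exp a s) + len (eval_exp b s)"
| "exp_time (Sub a b) s = exp_time a s + exp_time b s + len (eval_exp a s) + len (eval_exp b s)"
| "exp_time (Mul a b) s = exp_time a s + exp_time b s + len (eval_exp a s) + len (eval_exp b s)"
| "exp_time (Div a b) s = exp_time a s + exp_time b s + len (eval_exp a s) + len (eval_exp b s)"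

text \<open>
  \<open>exec c s t s'\<close>: started in memory \<open>s\<close>, program \<open>c\<close> halts after time \<open>t\<close> in memory \<open>s'\<close>.
  \<open>Store a e\<close> writes the value of \<open>e\<close> to the cell whose address is the value of \<open>a\<close>.
\<close>

inductive exec :: "com \<Rightarrow> memory \<Rightarrow> nat \<Rightarrow> memory \<Rightarrow> bool" where
  Skip: "exec Skip s 1 s"
| Store: "exec (Store a e) s
    (exp_time a s + exp_time e s + len (eval_exp a s) + len (eval_exp e s))
    (s(eval_exp a s := eval_exp e s))"
| Seq: "exec c s t s' \<Longrightarrow> exec d s' t' s'' \<Longrightarrow> exec (Seq c d) s (t + t') s''"
| If_True: "eval_exp e s > 0 \<Longrightarrow> exec c s t s' \<Longrightarrow>
    exec (If_Pos e c d) s (exp_time e s + len (eval_exp e s) + t) s'"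
| If_False: "eval_exp e s = 0 \<Longrightarrow> exec d s t s' \<Longrightarrow>
    exec (If_Pos e c d) s (exp_time e s + len (eval_exp e s) + t) s'"
| While_False: "eval_exp e s = 0 \<Longrightarrow>
    exec (While_Pos e c) s (exp_time e s + len (eval_exp e s)) s"
| While_True: "eval_exp e s > 0 \<Longrightarrow> exec c s t s' \<Longrightarrow> exec (While_Pos e c) s' t' s'' \<Longrightarrow>
    exec (While_Pos e c) s (exp_time e s + len (eval_exp e s) + t + t') s''"

inductive_cases exec_SkipE: "exec Skip s t s'"
inductive_cases exec_StoreE: "exec (Store a e) s t s'"
inductive_cases exec_SeqE: "exec (Seq c d) s t s'"
inductive_cases exec_IfE: "exec (If_Pos e c d) s t s'"
inductive_cases exec_WhileE: "exec (While_Pos e c) s t s'"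

lemma exec_deterministic:
  "exec c s t s' \<Longrightarrow> exec c s u r \<Longrightarrow> u = t \<and> r = s'"
proof (induction arbitrary: u r rule: exec.induct)
  case (Skip s)
  then show ?case by (auto elim: exec_SkipE)
next
  case (Store a e s)
  then show ?case by (auto elim: exec_StoreE)
next
  case (Seq c s t s' d t' s'')
  show ?case by (rule exec_SeqE[OF Seq.prems]) (use Seq.IH in auto)
next
  case (If_True e s c t s' d)
  show ?case by (rule exec_IfE[OF If_True.prems]) (use If_True.IH If_True.hyps(1) in auto)
next
  case (If_False e s d t s' c)
  show ?case by (rule exec_IfE[OF If_False.prems]) (use If_False.IH If_False.hyps(1) in auto)
next
  case (While_False e s c)
  show ?case by (rule exec_WhileE[OF While_False.prems]) (use While_False.hyps in auto)
next
  case (While_True e s c t s' t' s'')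
  show ?case
    by (rule exec_WhileE[OF While_True.prems]) (use While_True.IH While_True.hyps(1) in \<open>simp, blast\<close>)
qed

text \<open>
  A word list \<open>xs\<close> is passed to a program, and returned by it, with its length in cell 0 and its
  entries in cells 1, 2, and so on; all other cells are initially 0.
\<close>

definition load_input :: "nat list \<Rightarrow> memory" where
  "load_input xs a = (if a < Suc (length xs) then (length xs # xs) ! a else 0)"

definition read_output :: "memory \<Rightarrow> nat list" where
  "read_output s = map s [1..<Suc (s 0)]"

definition word_size :: "nat list \<Rightarrow> nat" where
  "word_size xs = sum_list (map len xs)"


section \<open>Minimization problems and approximation algorithms\<close>

record ('x, 's) min_problem =
  inputs :: "'x set"
  input_code :: "'x \<Rightarrow> nat list"
  solutions :: "'x \<Rightarrow> 's set"
  sol_code :: "'x \<Rightarrow> 's \<Rightarrow> nat list"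
  cost :: "'x \<Rightarrow> 's \<Rightarrow> real"

text \<open>
  The time bound is required on every input; the output is constrained only if the input has a
  feasible solution.
\<close>

definition polytime_approx_algorithm :: "real \<Rightarrow> ('x, 's) min_problem \<Rightarrow> com \<Rightarrow> bool" where
  "polytime_approx_algorithm \<alpha> Q c \<longleftrightarrow>
     (\<exists>k. \<forall>x \<in> inputs Q. \<exists>t s.
        exec c (load_input (input_code Q x)) t s \<and>
        t \<le> k * word_size (input_code Q x) ^ k + k \<and>
        (solutions Q x \<noteq> {} \<longrightarrow>
           (\<exists>S \<in> solutions Q x.
              read_output s = sol_code Q x S \<and>
              cost Q x S \<le> \<alpha> * Min (cost Q x ` solutions Q x))))"

definition polytime_approximable :: "real \<Rightarrow> ('x, 's) min_problem \<Rightarrow> bool" where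
  "polytime_approximable \<alpha> Q \<longleftrightarrow> (\<exists>c. polytime_approx_algorithm \<alpha> Q c)"


section \<open>Combinatorial problems with min-sum and top-$\ell$ objectives\<close>

text \<open>
  A combinatorial problem is a class of instances \<open>i\<close>, each with a finite ground set, enumerated by
  the list \<open>ground P i\<close>, and a family \<open>feasible P i\<close> of subsets of it. The word list
  \<open>code P i\<close> is the description of the instance (a graph, say) that algorithms receive; it is
  arbitrary, and the feasible family itself is not part of the input.
\<close>

record ('i, 'e) comb_problem =
  instances :: "'i set"
  code :: "'i \<Rightarrow> nat list"
  ground :: "'i \<Rightarrow> 'e list"
  feasible :: "'i \<Rightarrow> 'e set set"

definition is_comb_problem :: "('i, 'e) comb_problem \<Rightarrow> bool" where
  "is_comb_problem P \<longleftrightarrow>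
     (\<forall>i \<in> instances P. distinct (ground P i) \<and> feasible P i \<subseteq> Pow (set (ground P i)))"

definition rat_code :: "rat \<Rightarrow> nat list" where
  "rat_code r = (case quotient_of r of (p, q) \<Rightarrow> [nat p, nat q])"

definition valued_code :: "('i, 'e) comb_problem \<Rightarrow> 'i \<Rightarrow> ('e \<Rightarrow> rat) \<Rightarrow> nat list" where
  "valued_code P i v =
     length (ground P i) # concat (map (\<lambda>e. rat_code (v e)) (ground P i)) @ code P i"

definition subset_code :: "('i, 'e) comb_problem \<Rightarrow> 'i \<Rightarrow> 'e set \<Rightarrow> nat list" where
  "subset_code P i S = map (\<lambda>e. if e \<in> S then 1 else 0) (ground P i)"

definition restrict_vec :: "('e \<Rightarrow> rat) \<Rightarrow> 'e set \<Rightarrow> 'e \<Rightarrow> rat" where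
  "restrict_vec v S e = (if e \<in> S then v e else 0)"

definition top_sum :: "nat \<Rightarrow> rat list \<Rightarrow> rat" where
  "top_sum l xs = sum_list (take l (rev (sort (map abs xs))))"

definition min_sum_problem ::
  "('i, 'e) comb_problem \<Rightarrow> ('i \<times> ('e \<Rightarrow> rat), 'e set) min_problem" where
  "min_sum_problem P = \<lparr>
     inputs = {(i, v). i \<in> instances P \<and> (\<forall>e \<in> set (ground P i). v e \<ge> 0)},
     input_code = (\<lambda>(i, v). valued_code P i v),
     solutions = (\<lambda>(i, v). feasible P i),
     sol_code = (\<lambda>(i, v). subset_code P i),
     cost = (\<lambda>(i, v) S. of_rat (\<Sum>e\<in>S. v e)) \<rparr>"

text \<open>Here $\ell$ is part of the input.\<close>

definition top_min_problem ::
  "('i, 'e) comb_problem \<Rightarrow> ('i \<times> nat \<times> ('e \<Rightarrow> rat), 'e set) min_problem" where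
  "top_min_problem P = \<lparr>
     inputs = {(i, l, v). i \<in> instances P \<and> (\<forall>e \<in> set (ground P i). v e \<ge> 0)},
     input_code = (\<lambda>(i, l, v). l # valued_code P i v),
     solutions = (\<lambda>(i, l, v). feasible P i),
     sol_code = (\<lambda>(i, l, v). subset_code P i),
     cost = (\<lambda>(i, l, v) S. of_rat (top_sum l (map (restrict_vec v S) (ground P i)))) \<rparr>"

end

(*
  For every threshold w \<ge> 0, top_l(v[S]) \<le> l * w + (sum over e in S of max 0 (v_e - w)), with equality
  if w is the l-th largest entry of v[S] (or 0 if there are fewer than l entries). So an
  \<alpha>-approximation of the min-sum problem with values max 0 (v_e - w), for the threshold w that is
  tight for an optimal solution, is an \<alpha>-approximation of the top-l problem. Only 0 and the values
  v_e can be tight, so it suffices to run the min-sum algorithm once per candidate w and to keep the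
  solution for which the right-hand side is smallest. Multiplying all values by the product of their
  denominators makes them natural numbers, which avoids reducing fractions.
*)
theory Submission
  imports Defs "HOL-Library.Multiset"
begin

section \<open>Top sums and thresholds\<close>

text \<open>The obstacle is to call an arbitrary program \<open>c\<close> n + 1 times within one
  program. It relies on zeros beyond its input and may leave any cell dirty, so each call gets a
  fresh memory of its own. No extent of these memories is known in advance, hence they are
  interleaved rather than laid out in blocks. Logarithmic cost keeps everything polynomial: a run of
  time T stores no number longer than T, so one bound on the lengths of all cell contents serves for
  the whole execution. The time bound is also due when there is no feasible solution and the outputs
  of \<open>c\<close> are arbitrary. Therefore the execution is described through the final memories
  of the calls alone, and solutions enter only in the last section. Clipping a scaled value at the
  threshold is truncated subtraction of naturals, and a positive scale factor does not change an
  approximation ratio. The condition \<alpha> \<ge> 1 is what lets the exact term l * w be bounded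
  together with the approximated sum.\<close>

lemma top_sum_le_threshold:
  assumes "\<forall>x \<in> set xs. 0 \<le> x" "0 \<le> w"
  shows "top_sum l xs \<le> of_nat l * w + (\<Sum>x\<leftarrow>xs. max 0 (x - w))"
proof -
  define ys where "ys = rev (sort xs)"
  have abs: "map abs xs = xs"
    using assms(1) by (intro map_idI) auto
  have "sum_list (take l ys) \<le> (\<Sum>x\<leftarrow>take l ys. w + max 0 (x - w))"
    using sum_list_mono[of "take l ys" "\<lambda>x. x" "\<lambda>x. w + max 0 (x - w)"] by fastforce
  also have "\<dots> = of_nat (length (take l ys)) * w + (\<Sum>x\<leftarrow>take l ys. max 0 (x - w))"
    by (simp add: sum_list_addf sum_list_triv)
  \<comment> \<open>The prefix has at most l entries and w is nonnegative; the positive parts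
    dropped with the other entries are nonnegative too.\<close>
  also have "\<dots> \<le> of_nat l * w + (\<Sum>x\<leftarrow>ys. max 0 (x - w))"
  proof (rule add_mono)
    show "of_nat (length (take l ys)) * w \<le> of_nat l * w"
      using assms(2) by (intro mult_right_mono) auto
    have "(\<Sum>x\<leftarrow>ys. max 0 (x - w)) = (\<Sum>x\<leftarrow>take l ys. max 0 (x - w)) + (\<Sum>x\<leftarrow>drop l ys. max 0 (x - w))"
      by (metis append_take_drop_id map_append sum_list_append)
    moreover have "0 \<le> (\<Sum>x\<leftarrow>drop l ys. max 0 (x - w))"
      by (intro sum_list_nonneg) auto
    ultimately show "(\<Sum>x\<leftarrow>take l ys. max 0 (x - w)) \<le> (\<Sum>x\<leftarrow>ys. max 0 (x - w))"
      by linarith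
  qed
  also have "(\<Sum>x\<leftarrow>ys. max 0 (x - w)) = (\<Sum>x\<leftarrow>xs. max 0 (x - w))"
    unfolding sum_mset_sum_list[symmetric] ys_def by simp
  finally show ?thesis
    by (simp add: top_sum_def abs ys_def)
qed

lemma top_sum_eq_threshold:
  assumes "\<forall>x \<in> set xs. 0 \<le> x" "1 \<le> l"
  shows "\<exists>w \<in> insert 0 (set xs). top_sum l xs = of_nat l * w + (\<Sum>x\<leftarrow>xs. max 0 (x - w))"
proof -
  define ys where "ys = rev (sort xs)"
  have abs: "map abs xs = xs"
    using assms(1) by (intro map_idI) auto
  have top: "top_sum l xs = sum_list (take l ys)"
    by (simp add: top_sum_def abs ys_def)
  have perm: "(\<Sum>x\<leftarrow>xs. max 0 (x - w)) = (\<Sum>x\<leftarrow>ys. max 0 (x - w))" for w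
    unfolding sum_mset_sum_list[symmetric] ys_def by simp
  show ?thesis
  proof (cases "l \<le> length ys")
    case False
    have "map (max 0) ys = ys"
      using assms(1) by (intro map_idI) (auto simp: ys_def)
    with False show ?thesis
      using perm[of 0] by (intro bexI[of _ 0]) (simp_all add: top)
  next
    case True
    define w where "w = ys ! (l - 1)"
    have decr: "ys ! b \<le> ys ! a" if "a \<le> b" "b < length ys" for a b
      using sorted_rev_nth_mono[of ys a b] that by (simp add: ys_def)
    have hi: "w \<le> x" if "x \<in> set (take l ys)" for x
      using that True assms(2) decr[of _ "l - 1"] by (auto simp: w_def in_set_conv_nth)
    have lo: "x \<le> w" if "x \<in> set (drop l ys)" for x
      using that True assms(2) decr[of "l - 1"] by (auto simp: w_def in_set_conv_nth)
    \<comment> \<open>Since w sits at the last position of the prefix, every positive part is x - w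
      on the prefix and 0 behind it, so the l copies of w cancel exactly.\<close>
    have "(\<Sum>x\<leftarrow>ys. max 0 (x - w)) = (\<Sum>x\<leftarrow>take l ys. max 0 (x - w)) + (\<Sum>x\<leftarrow>drop l ys. max 0 (x - w))"
      by (metis append_take_drop_id map_append sum_list_append)
    moreover have "map (\<lambda>x. max 0 (x - w)) (take l ys) = map (\<lambda>x. x - w) (take l ys)"
      using hi by (intro map_cong) auto
    moreover have "map (\<lambda>x. max 0 (x - w)) (drop l ys) = map (\<lambda>x. 0) (drop l ys)"
      using lo by (intro map_cong) auto
    ultimately have "(\<Sum>x\<leftarrow>ys. max 0 (x - w)) = sum_list (take l ys) - of_nat l * w"
      using True by (simp add: sum_list_subtractf sum_list_triv)
    moreover have "w \<in> set xs"
      using True assms(2) nth_mem[of "l - 1" ys] by (simp add: w_def ys_def)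
    ultimately show ?thesis
      by (intro bexI[of _ w]) (simp_all add: top perm)
  qed
qed

section \<open>Executions with bounded cell contents\<close>

lemma len_le_Suc_iff: "len x \<le> Suc b \<longleftrightarrow> x < 2 ^ b"
  by (auto simp: len_def floorlog_le_iff)

lemma len_ge_1: "1 \<le> len x"
  by (simp add: len_def)

lemma len_mono: "x \<le> y \<Longrightarrow> len x \<le> len y"
  by (simp add: len_def floorlog_mono)

text \<open>Each length includes a delimiter, and the second delimiter pays for the carry
  bit.\<close>

lemma len_add: "len (x + y) \<le> len x + len y"
proof -
  obtain a b where ab: "len x = Suc a" "len y = Suc b"
    by (simp add: len_def)
  have "x < 2 ^ a" "y < 2 ^ b"
    using ab len_le_Suc_iff by (metis le_refl)+
  moreover have "(2::nat) ^ a \<le> 2 ^ (a + b)" "(2::nat) ^ b \<le> 2 ^ (a + b)"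
    by simp_all
  ultimately have "x + y < 2 ^ Suc (a + b)"
    by (simp only: power_Suc)
  then show ?thesis
    using ab len_le_Suc_iff[of "x + y" "Suc (a + b)"] by simp
qed

lemma len_mult: "len (x * y) \<le> len x + len y"
proof -
  obtain a b where ab: "len x = Suc a" "len y = Suc b"
    by (simp add: len_def)
  have "x < 2 ^ a" "y < 2 ^ b"
    using ab len_le_Suc_iff by (metis le_refl)+
  then have "x * y < 2 ^ (a + b)"
    by (simp add: power_add mult_strict_mono')
  then show ?thesis
    using ab len_le_Suc_iff[of "x * y" "a + b"] by simp
qed

lemma len_le: "len x \<le> Suc x"
  by (simp add: len_le_Suc_iff)

text \<open>A static factor: if all cell contents have length at most \<open>B\<close>, the value of
  the expression has length at most \<open>esize\<close> times \<open>B\<close>. A memory read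
  counts 1, however large its address expression is.\<close>

fun esize :: "exp \<Rightarrow> nat" where
  "esize (Const n) = len n"
| "esize (Mem a) = 1"
| "esize (Add a b) = esize a + esize b"
| "esize (Sub a b) = esize a + esize b"
| "esize (Mul a b) = esize a + esize b"
| "esize (Div a b) = esize a + esize b"

fun etime :: "exp \<Rightarrow> nat" where
  "etime (Const n) = len n"
| "etime (Mem a) = etime a + esize a + 1"
| "etime (Add a b) = etime a + etime b + esize a + esize b"
| "etime (Sub a b) = etime a + etime b + esize a + esize b"
| "etime (Mul a b) = etime a + etime b + esize a + esize b"
| "etime (Div a b) = etime a + etime b + esize a + esize b"

text \<open>A loop is counted once, because its iterations go into the factor \<open>k\<close> of
  \<open>runs\<close>. A conditional is charged for both branches, which makes the weight
  independent of the memory.\<close>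

fun ctime :: "com \<Rightarrow> nat" where
  "ctime Skip = 1"
| "ctime (Store a e) = etime a + etime e + esize a + esize e"
| "ctime (Seq c d) = ctime c + ctime d"
| "ctime (If_Pos e c d) = etime e + esize e + ctime c + ctime d"
| "ctime (While_Pos e c) = etime e + esize e + ctime c"

definition bnd :: "nat \<Rightarrow> memory \<Rightarrow> bool" where
  "bnd B s \<longleftrightarrow> (\<forall>a. len (s a) \<le> B)"

lemma bnd_ge_1: "bnd B s \<Longrightarrow> 1 \<le> B"
  unfolding bnd_def using len_ge_1 le_trans by blast

lemma len_eval_exp: "bnd B s \<Longrightarrow> len (eval_exp e s) \<le> esize e * B"
proof (induction e)
  case (Const n)
  then show ?case using bnd_ge_1[of B s] by simp
next
  case (Mem e)
  then show ?case by (simp add: bnd_def)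
next
  case (Add e f)
  then show ?case
    using len_add[of "eval_exp e s" "eval_exp f s"] by (simp add: algebra_simps)
next
  case (Sub e f)
  then show ?case
    using len_mono[of "eval_exp e s - eval_exp f s" "eval_exp e s"] by (simp add: algebra_simps)
next
  case (Mul e f)
  then show ?case
    using len_mult[of "eval_exp e s" "eval_exp f s"] by (simp add: algebra_simps)
next
  case (Div e f)
  then show ?case
    using len_mono[of "eval_exp e s div eval_exp f s" "eval_exp e s"] by (simp add: algebra_simps)
qed

lemma exp_time_le: "bnd B s \<Longrightarrow> exp_time e s \<le> etime e * B"
proof (induction e)
  case (Const n)
  then show ?case using bnd_ge_1[of B s] by simp
next
  case (Mem e)
  then have "len (s (eval_exp e s)) \<le> B" by (simp add: bnd_def)
  with Mem show ?case using len_eval_exp[of B s e] by (simp add: algebra_simps)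
next
  case (Add e f)
  then show ?case
    using len_eval_exp[of B s e] len_eval_exp[of B s f] by (simp add: algebra_simps)
next
  case (Sub e f)
  then show ?case
    using len_eval_exp[of B s e] len_eval_exp[of B s f] by (simp add: algebra_simps)
next
  case (Mul e f)
  then show ?case
    using len_eval_exp[of B s e] len_eval_exp[of B s f] by (simp add: algebra_simps)
next
  case (Div e f)
  then show ?case
    using len_eval_exp[of B s e] len_eval_exp[of B s f] by (simp add: algebra_simps)
qed

lemma exp_time_pos: "1 \<le> exp_time e s"
  by (induction e) (simp_all add: len_def)

text \<open>
  Charging every step with the static size of the whole program makes the factor \<open>k\<close> of a sequential
  composition the maximum, not the sum, of the factors of its parts; only loops multiply it.
\<close>

definition runs :: "nat \<Rightarrow> nat \<Rightarrow> com \<Rightarrow> memory \<Rightarrow> memory \<Rightarrow> bool" where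
  "runs B k c s s' \<longleftrightarrow> (\<exists>t. exec c s t s' \<and> t \<le> k * (ctime c * B))"

lemma test_time: "bnd B s \<Longrightarrow> exp_time e s + len (eval_exp e s) \<le> (etime e + esize e) * B"
  using exp_time_le[of B s e] len_eval_exp[of B s e] by (simp add: algebra_simps)

lemma runs_Skip: "1 \<le> k \<Longrightarrow> 1 \<le> B \<Longrightarrow> runs B k Skip s s"
  unfolding runs_def using exec.Skip[of s] by (intro exI[of _ 1]) simp

lemma runs_Store:
  assumes "1 \<le> k" "bnd B s" "s' = s(eval_exp a s := eval_exp e s)"
  shows "runs B k (Store a e) s s'"
proof -
  have "exp_time a s + exp_time e s + len (eval_exp a s) + len (eval_exp e s) \<le> ctime (Store a e) * B"
    using test_time[OF assms(2), of a] test_time[OF assms(2), of e] by (simp add: algebra_simps)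
  also have "\<dots> \<le> k * (ctime (Store a e) * B)"
    using assms(1) by simp
  finally show ?thesis
    unfolding runs_def assms(3) using exec.Store by blast
qed

lemma runs_Seq:
  assumes "runs B k c s s'" "runs B k d s' s''"
  shows "runs B k (Seq c d) s s''"
proof -
  obtain t t' where "exec c s t s'" "t \<le> k * (ctime c * B)" "exec d s' t' s''" "t' \<le> k * (ctime d * B)"
    using assms unfolding runs_def by blast
  then show ?thesis
    unfolding runs_def by (intro exI[of _ "t + t'"] conjI) (rule exec.Seq, simp_all add: algebra_simps)
qed

lemma runs_mono: "runs B k c s s' \<Longrightarrow> k \<le> k' \<Longrightarrow> runs B k' c s s'"
  unfolding runs_def by (meson le_trans mult_le_mono1)

lemma runs_If_True:
  assumes "0 < eval_exp e s" "bnd B s" "runs B k c s s'" "1 \<le> k"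
  shows "runs B k (If_Pos e c d) s s'"
proof -
  obtain t where t: "exec c s t s'" "t \<le> k * (ctime c * B)"
    using assms(3) unfolding runs_def by blast
  have "exp_time e s + len (eval_exp e s) \<le> k * ((etime e + esize e) * B)"
    by (rule le_trans[OF test_time[OF assms(2), of e]]) (use assms(4) in simp)
  with t have "exp_time e s + len (eval_exp e s) + t \<le> k * (ctime (If_Pos e c d) * B)"
    by (simp add: algebra_simps)
  then show ?thesis
    unfolding runs_def using exec.If_True[OF assms(1) t(1)] by blast
qed

lemma runs_If_False:
  assumes "eval_exp e s = 0" "bnd B s" "runs B k d s s'" "1 \<le> k"
  shows "runs B k (If_Pos e c d) s s'"
proof -
  obtain t where t: "exec d s t s'" "t \<le> k * (ctime d * B)"
    using assms(3) unfolding runs_def by blast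
  have "exp_time e s + len (eval_exp e s) \<le> k * ((etime e + esize e) * B)"
    by (rule le_trans[OF test_time[OF assms(2), of e]]) (use assms(4) in simp)
  with t have "exp_time e s + len (eval_exp e s) + t \<le> k * (ctime (If_Pos e c d) * B)"
    by (simp add: algebra_simps)
  then show ?thesis
    unfolding runs_def using exec.If_False[OF assms(1) t(1)] by blast
qed

lemma runs_While_False:
  assumes "eval_exp e s = 0" "bnd B s"
  shows "runs B 1 (While_Pos e c) s s"
  unfolding runs_def using exec.While_False[OF assms(1)] test_time[OF assms(2), of e]
  by (intro exI conjI) (auto simp: algebra_simps)

lemma runs_While_True:
  assumes "0 < eval_exp e s" "bnd B s" "runs B k c s s'" "runs B k' (While_Pos e c) s' s''" "1 \<le> k"
  shows "runs B (k + k') (While_Pos e c) s s''"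
proof -
  obtain t t' where t: "exec c s t s'" "t \<le> k * (ctime c * B)"
    "exec (While_Pos e c) s' t' s''" "t' \<le> k' * (ctime (While_Pos e c) * B)"
    using assms(3,4) unfolding runs_def by blast
  have "exp_time e s + len (eval_exp e s) \<le> k * ((etime e + esize e) * B)"
    by (rule le_trans[OF test_time[OF assms(2), of e]]) (use assms(5) in simp)
  with t have "exp_time e s + len (eval_exp e s) + t + t' \<le> (k + k') * (ctime (While_Pos e c) * B)"
    by (simp add: algebra_simps)
  then show ?thesis
    unfolding runs_def using exec.While_True[OF assms(1) t(1,3)] by blast
qed

text \<open>\<open>S i\<close> is the memory after i iterations. The factor is \<open>Suc n\<close>
  because the final failing test is charged like one more iteration.\<close>

lemma runs_While:
  assumes "\<And>i. i < n \<Longrightarrow> 0 < eval_exp e (S i)" "eval_exp e (S n) = 0"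
    and "\<And>i. i \<le> n \<Longrightarrow> bnd B (S i)"
    and "\<And>i. i < n \<Longrightarrow> runs B k c (S i) (S (Suc i))"
    and "1 \<le> k"
  shows "runs B (Suc n * k) (While_Pos e c) (S 0) (S n)"
proof -
  \<comment> \<open>The induction is on the number d of iterations that remain, since the loop rule
    adds an iteration at the front.\<close>
  have "runs B (Suc d * k) (While_Pos e c) (S (n - d)) (S n)" if "d \<le> n" for d
    using that
  proof (induction d)
    case 0
    show ?case
      using runs_mono[OF runs_While_False[OF assms(2), of B c]] assms(3)[of n] assms(5) by simp
  next
    case (Suc d)
    then have *: "n - Suc d < n" "Suc (n - Suc d) = n - d" by auto
    show ?case
      using runs_While_True[OF assms(1)[OF *(1)] assms(3) assms(4)[OF *(1)], of "Suc d * k"] Suc *(2) assms(5)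
      by simp
  qed
  from this[of n] show ?thesis by simp
qed

text \<open>A store is charged for the length of the value written, so nothing longer than the
  running time can be created.\<close>

lemma bnd_exec: "exec c s t s' \<Longrightarrow> t \<le> B \<Longrightarrow> bnd B s \<Longrightarrow> bnd B s'"
  by (induction rule: exec.induct) (auto simp: bnd_def)

section \<open>Simulating a program inside a larger memory\<close>

text \<open>
  Beyond an input \<open>ws\<close>, which stays in place with its length in cell 0, the memory holds eight
  variables \<open>xs\<close>, followed by \<open>N\<close> interleaved memories: cell \<open>a\<close> of \<open>R j\<close> is stored at offset
  \<open>a * N + j\<close>. Running a program once in each of these memories makes it start every time from
  cleared cells. Variables 0 and 1 contain \<open>N\<close> and the index of the memory in use.
\<close>

definition layout :: "nat \<Rightarrow> nat list \<Rightarrow> nat list \<Rightarrow> (nat \<Rightarrow> nat \<Rightarrow> nat) \<Rightarrow> memory" where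
  "layout N ws xs R a =
     (if a \<le> length ws then (length ws # ws) ! a
      else if a \<le> length ws + 8 then xs ! (a - Suc (length ws))
      else R ((a - (length ws + 9)) mod N) ((a - (length ws + 9)) div N))"

text \<open>The input length is not known to the program text, so variables are addressed relative
  to cell 0, which must keep that length.\<close>

definition var_addr :: "nat \<Rightarrow> exp" where
  "var_addr k = Add (Mem (Const 0)) (Const (Suc k))"

definition Var :: "nat \<Rightarrow> exp" where
  "Var k = Mem (var_addr k)"

text \<open>\<open>var_addr 8\<close> is the first cell beyond the eight variables, where the
  interleaved memories begin.\<close>

definition cell_addr :: "exp \<Rightarrow> exp" where
  "cell_addr e = Add (var_addr 8) (Add (Mul e (Var 0)) (Var 1))"

definition Cell :: "exp \<Rightarrow> exp" where
  "Cell e = Mem (cell_addr e)"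

fun sim_exp :: "exp \<Rightarrow> exp" where
  "sim_exp (Const n) = Const n"
| "sim_exp (Mem a) = Cell (sim_exp a)"
| "sim_exp (Add a b) = Add (sim_exp a) (sim_exp b)"
| "sim_exp (Sub a b) = Sub (sim_exp a) (sim_exp b)"
| "sim_exp (Mul a b) = Mul (sim_exp a) (sim_exp b)"
| "sim_exp (Div a b) = Div (sim_exp a) (sim_exp b)"

fun sim :: "com \<Rightarrow> com" where
  "sim Skip = Skip"
| "sim (Store a e) = Store (cell_addr (sim_exp a)) (sim_exp e)"
| "sim (Seq c d) = Seq (sim c) (sim d)"
| "sim (If_Pos e c d) = If_Pos (sim_exp e) (sim c) (sim d)"
| "sim (While_Pos e c) = While_Pos (sim_exp e) (sim c)"

lemma layout_0 [simp]: "layout N ws xs R 0 = length ws"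
  by (simp add: layout_def)

lemma layout_Suc: "a < length ws \<Longrightarrow> layout N ws xs R (Suc a) = ws ! a"
  by (simp add: layout_def)

lemma eval_var_addr [simp]: "eval_exp (var_addr k) (layout N ws xs R) = length ws + Suc k"
  by (simp add: var_addr_def)

lemma eval_Var [simp]: "k < 8 \<Longrightarrow> eval_exp (Var k) (layout N ws xs R) = xs ! k"
  by (simp add: Var_def layout_def)

lemma eval_cell_addr:
  "eval_exp (cell_addr e) (layout N ws xs R) =
     length ws + 9 + (eval_exp e (layout N ws xs R) * xs ! 0 + xs ! 1)"
  by (simp add: cell_addr_def)

lemma eval_Cell [simp]:
  "xs ! 0 = N \<Longrightarrow> xs ! 1 < N \<Longrightarrow>
     eval_exp (Cell e) (layout N ws xs R) = R (xs ! 1) (eval_exp e (layout N ws xs R))"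
  by (simp add: Cell_def eval_cell_addr) (simp add: layout_def)

lemma layout_update_input:
  "a < length ws \<Longrightarrow> (layout N ws xs R)(Suc a := y) = layout N (ws[a := y]) xs R"
  by (rule ext) (auto simp: layout_def nth_Cons nth_list_update split: nat.splits)

lemma layout_update_var:
  "k < 8 \<Longrightarrow> length xs = 8 \<Longrightarrow>
     (layout N ws xs R)(length ws + Suc k := y) = layout N ws (xs[k := y]) R"
  by (rule ext) (auto simp: layout_def nth_list_update)

text \<open>Quotient and remainder by \<open>N\<close> determine an offset, so the write hits a
  single cell of a single memory.\<close>

lemma layout_update_cell:
  assumes "j < N"
  shows "(layout N ws xs R)(length ws + 9 + (a * N + j) := y) = layout N ws xs (R(j := (R j)(a := y)))"
proof (rule ext)
  fix b
  show "((layout N ws xs R)(length ws + 9 + (a * N + j) := y)) b =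
      layout N ws xs (R(j := (R j)(a := y))) b"
  proof (cases "b \<le> length ws + 8")
    case True
    then show ?thesis by (simp add: layout_def)
  next
    case False
    then obtain d where d: "b = length ws + 9 + d"
      using le_Suc_ex[of "length ws + 9" b] by auto
    have "d = a * N + j \<longleftrightarrow> d mod N = j \<and> d div N = a"
      using assms by (metis div_mult_mod_eq div_mult_self3 div_less add_0_right less_nat_zero_code mod_mult_self3 mod_less)
    then show ?thesis
      unfolding d by (auto simp: layout_def)
  qed
qed

lemma bnd_layout:
  assumes "length xs = 8" "len (length ws) \<le> B" "\<forall>x \<in> set ws. len x \<le> B" "\<forall>x \<in> set xs. len x \<le> B"
    "\<forall>j. bnd B (R j)"
  shows "bnd B (layout N ws xs R)"
  using assms by (auto simp: bnd_def layout_def nth_Cons split: nat.splits)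

lemma runs_Store_var:
  assumes "1 \<le> k" "bnd B (layout N ws xs R)" "v < 8" "length xs = 8"
    "xs' = xs[v := eval_exp e (layout N ws xs R)]"
  shows "runs B k (Store (var_addr v) e) (layout N ws xs R) (layout N ws xs' R)"
  using assms by (intro runs_Store) (auto simp: layout_update_var[symmetric])

lemma runs_Store_cell:
  assumes "1 \<le> k" "bnd B (layout N ws xs R)" "xs ! 0 = N" "xs ! 1 = j" "j < N"
    "R' = R(j := (R j)(eval_exp a (layout N ws xs R) := eval_exp e (layout N ws xs R)))"
  shows "runs B k (Store (cell_addr a) e) (layout N ws xs R) (layout N ws xs R')"
  using assms layout_update_cell[OF assms(5)]
  by (intro runs_Store) (auto simp: eval_cell_addr)

lemma runs_Store_input:
  assumes "1 \<le> k" "bnd B (layout N ws xs R)" "eval_exp a (layout N ws xs R) = Suc i" "i < length ws"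
    "ws' = ws[i := eval_exp e (layout N ws xs R)]"
  shows "runs B k (Store a e) (layout N ws xs R) (layout N ws' xs R)"
  using assms layout_update_input[OF assms(4), of N xs R]
  by (intro runs_Store) auto

lemma eval_sim_exp:
  assumes "xs ! 0 = N" "xs ! 1 = j" "j < N"
  shows "eval_exp (sim_exp e) (layout N ws xs R) = eval_exp e (R j)"
  by (induction e) (use assms in auto)

text \<open>The running time t of the original execution serves as the factor: every construct costs
  at least 1 there, while its simulated counterpart costs at most its static weight times
  \<open>B\<close>. The last assumption bounds the whole layout at every intermediate memory, which
  \<open>bnd_exec\<close> in turn keeps bounded.\<close>

lemma runs_sim:
  assumes "exec c s t s'" "t \<le> B" "bnd B s" "xs ! 0 = N" "xs ! 1 = j" "j < N"
    and "\<And>r. bnd B r \<Longrightarrow> bnd B (layout N ws xs (R(j := r)))"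
  shows "runs B t (sim c) (layout N ws xs (R(j := s))) (layout N ws xs (R(j := s')))"
  using assms(1-3)
proof (induction rule: exec.induct)
  case (Skip s)
  then show ?case using bnd_ge_1 by (auto intro: runs_Skip)
next
  case (Store a e s)
  show ?case unfolding sim.simps
    by (rule runs_Store_cell[OF _ assms(7)[OF Store(2)] assms(4-6)])
      (use exp_time_pos[of a s] in \<open>simp_all add: eval_sim_exp[OF assms(4-6)] fun_eq_iff\<close>)
next
  case (Seq c s t s' d t' s'')
  have "bnd B s'"
    using bnd_exec[OF Seq.hyps(1)] Seq.prems by simp
  have t: "t \<le> B" "t' \<le> B"
    using Seq.prems(1) by simp_all
  show ?case unfolding sim.simps
    by (rule runs_Seq[OF runs_mono[OF Seq.IH(1)[OF t(1) Seq.prems(2)]]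
        runs_mono[OF Seq.IH(2)[OF t(2) \<open>bnd B s'\<close>]]]) simp_all
next
  case (If_True e s c t s' d)
  have "runs B t (sim c) (layout N ws xs (R(j := s))) (layout N ws xs (R(j := s')))"
    by (rule If_True.IH; use If_True.prems in simp)
  then have IH: "runs B (exp_time e s + len (eval_exp e s) + t) (sim c)
      (layout N ws xs (R(j := s))) (layout N ws xs (R(j := s')))"
    by (rule runs_mono) simp
  show ?case unfolding sim.simps
    by (rule runs_If_True[OF _ assms(7)[OF If_True.prems(2)] IH])
      (use exp_time_pos[of e s] If_True.hyps(1) in \<open>simp_all add: eval_sim_exp[OF assms(4-6)]\<close>)
next
  case (If_False e s d t s' c)
  have "runs B t (sim d) (layout N ws xs (R(j := s))) (layout N ws xs (R(j := s')))"
    by (rule If_False.IH; use If_False.prems in simp)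
  then have IH: "runs B (exp_time e s + len (eval_exp e s) + t) (sim d)
      (layout N ws xs (R(j := s))) (layout N ws xs (R(j := s')))"
    by (rule runs_mono) simp
  show ?case unfolding sim.simps
    by (rule runs_If_False[OF _ assms(7)[OF If_False.prems(2)] IH])
      (use exp_time_pos[of e s] If_False.hyps(1) in \<open>simp_all add: eval_sim_exp[OF assms(4-6)]\<close>)
next
  case (While_False e s c)
  have "runs B 1 (sim (While_Pos e c)) (layout N ws xs (R(j := s))) (layout N ws xs (R(j := s)))"
    unfolding sim.simps
    by (rule runs_While_False[OF _ assms(7)[OF While_False.prems(2)]])
      (use While_False.hyps in \<open>simp add: eval_sim_exp[OF assms(4-6)]\<close>)
  then show ?case
    by (rule runs_mono) (use exp_time_pos[of e s] in simp)
next
  case (While_True e s c t s' t' s'')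
  have t': "t' \<le> B"
    using While_True.prems(1) by simp
  have "bnd B s'"
    using bnd_exec[OF While_True.hyps(2)] While_True.prems by simp
  have "runs B t (sim c) (layout N ws xs (R(j := s))) (layout N ws xs (R(j := s')))"
    by (rule While_True.IH(1); use While_True.prems in simp)
  then have 1: "runs B (exp_time e s + len (eval_exp e s) + t) (sim c)
      (layout N ws xs (R(j := s))) (layout N ws xs (R(j := s')))"
    by (rule runs_mono) simp
  have 2: "runs B t' (While_Pos (sim_exp e) (sim c))
      (layout N ws xs (R(j := s'))) (layout N ws xs (R(j := s'')))"
    by (rule While_True.IH(2)[unfolded sim.simps, OF t' \<open>bnd B s'\<close>])
  show ?case unfolding sim.simps
    by (rule runs_While_True[OF _ assms(7)[OF While_True.prems(2)] 1 2])
      (use While_True.hyps(1) While_True.prems exp_time_pos[of e s] in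
        \<open>simp_all add: eval_sim_exp[OF assms(4-6)]\<close>)
qed

section \<open>The reduction as a program\<close>

text \<open>
  The input cells 0, 1, 2 contain the length, \<open>l\<close> and the number \<open>n\<close> of elements; cells \<open>3 + 2 * i\<close> and
  \<open>4 + 2 * i\<close> contain the numerator and denominator of the \<open>i\<close>-th value. Variables: 0 number \<open>n + 1\<close> of
  rounds, 1 current round, 2 common denominator, 3 loop counter, 4 scaled threshold, 5 objective of
  the current round, 6 best round so far, 7 its objective.
\<close>

definition num_exp :: "exp \<Rightarrow> exp" where
  "num_exp e = Mem (Add (Const 3) (Add e e))"

definition den_exp :: "exp \<Rightarrow> exp" where
  "den_exp e = Mem (Add (Const 4) (Add e e))"

definition val_exp :: "exp \<Rightarrow> exp" where
  "val_exp e = Mul (num_exp e) (Div (Var 2) (den_exp e))"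

definition count_exp :: exp where
  "count_exp = Sub (Var 0) (Const 1)"

definition incr :: "nat \<Rightarrow> com" where
  "incr k = Store (var_addr k) (Add (Var k) (Const 1))"

text \<open>All loops share counter 3 and rely on finding it at 0, so each one clears it when it
  ends.\<close>

definition for_each :: "com \<Rightarrow> com" where
  "for_each c = Seq (While_Pos (Sub count_exp (Var 3)) (Seq c (incr 3))) (Store (var_addr 3) (Const 0))"

definition prepare :: com where
  "prepare = Seq (Store (var_addr 0) (Add (Mem (Const 2)) (Const 1)))
     (Seq (Store (var_addr 2) (Const 1))
       (for_each (Store (var_addr 2) (Mul (Var 2) (den_exp (Var 3))))))"

text \<open>The rounds below n try the values themselves; round n supplies the candidate 0.\<close>

definition set_threshold :: com where
  "set_threshold = If_Pos (Sub count_exp (Var 1))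
     (Store (var_addr 4) (val_exp (Var 1))) (Store (var_addr 4) (Const 0))"

text \<open>The leading entry \<open>l\<close> is not part of the min-sum input. This accounts for
  the decremented length and for the shift by one between source and target cells.\<close>

definition copy_input :: com where
  "copy_input =
     Seq (Store (cell_addr (Const 0)) (Sub (Mem (Const 0)) (Const 1)))
       (Seq (While_Pos (Sub (Mem (Const 0)) (Add (Var 3) (Const 1)))
         (Seq (Store (cell_addr (Add (Var 3) (Const 1))) (Mem (Add (Var 3) (Const 2)))) (incr 3)))
       (Store (var_addr 3) (Const 0)))"

text \<open>\<open>Sub\<close> truncates at 0 and thus yields the positive part. With
  \<open>l\<close> gone, the pairs start at cell 2 of the simulated memory instead of cell
  3.\<close>

definition shift_values :: com where
  "shift_values = for_each
     (Seq (Store (cell_addr (Add (Const 2) (Add (Var 3) (Var 3)))) (Sub (val_exp (Var 3)) (Var 4)))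
       (Store (cell_addr (Add (Const 3) (Add (Var 3) (Var 3)))) (Const 1)))"

text \<open>The objective is the threshold upper bound rather than the top sum itself, so the
  program never has to sort.\<close>

definition evaluate :: com where
  "evaluate = Seq (Store (var_addr 5) (Mul (Mem (Const 1)) (Var 4)))
     (for_each (If_Pos (Cell (Add (Var 3) (Const 1)))
       (Store (var_addr 5) (Add (Var 5) (Sub (val_exp (Var 3)) (Var 4)))) Skip))"

text \<open>The sum acts as a disjunction: its first term is positive only in round 0, which is
  always accepted because variable 7 holds no objective yet.\<close>

definition keep_best :: com where
  "keep_best = If_Pos (Add (Sub (Const 1) (Var 1)) (Sub (Var 7) (Var 5)))
     (Seq (Store (var_addr 7) (Var 5)) (Store (var_addr 6) (Var 1))) Skip"

definition next_round :: com where
  "next_round = Seq (Store (var_addr 4) (Const 0)) (Seq (Store (var_addr 5) (Const 0)) (incr 1))"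

definition search_round :: "com \<Rightarrow> com" where
  "search_round c = Seq set_threshold (Seq copy_input (Seq shift_values
     (Seq (sim c) (Seq evaluate (Seq keep_best next_round)))))"

text \<open>Setting variable 1 to the best round makes \<open>Cell\<close> read that round's memory.
  Cell 0 is overwritten last, since every variable is addressed through it.\<close>

definition write_output :: com where
  "write_output = Seq (Store (var_addr 1) (Var 6))
     (Seq (for_each (Store (Add (Var 3) (Const 1)) (Cell (Add (Var 3) (Const 1)))))
       (Store (Const 0) count_exp))"

definition search :: "com \<Rightarrow> com" where
  "search c = Seq prepare
     (Seq (While_Pos (Sub (Var 0) (Var 1)) (search_round c)) write_output)"

lemma length_concat_pairs [simp]: "length (concat (map (\<lambda>i. [a i, b i]) xs)) = 2 * length xs"
  by (induction xs) auto

lemma nth_concat_pairs: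
  "i < n \<Longrightarrow> concat (map (\<lambda>i. [a i, b i]) [0..<n]) ! (2 * i) = a i"
  "i < n \<Longrightarrow> concat (map (\<lambda>i. [a i, b i]) [0..<n]) ! Suc (2 * i) = b i"
  by (induction n) (auto simp: nth_append less_Suc_eq)

lemma list_update_Cons_numeral [simp]:
  "(x # xs)[numeral v := y] = x # xs[numeral v - 1 := y]"
  by (simp add: numeral_eq_Suc)

lemma load_input_update:
  "i < length us \<Longrightarrow> (load_input us)(Suc i := y) = load_input (us[i := y])"
  by (rule ext) (auto simp: load_input_def nth_Cons split: nat.splits)

lemma bnd_load_input:
  assumes "len (length us) \<le> B" "\<forall>x \<in> set us. len x \<le> B"
  shows "bnd B (load_input us)"
  unfolding bnd_def
proof
  fix a
  show "len (load_input us a) \<le> B"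
  proof (cases "a < Suc (length us)")
    case True
    then have "load_input us a \<in> set (length us # us)"
      using nth_mem[of a "length us # us"] by (simp add: load_input_def)
    with assms show ?thesis by auto
  next
    case False
    then show ?thesis
      using assms(1) len_mono[of 0 "length us"] by (simp add: load_input_def)
  qed
qed

section \<open>Quantities computed by the search\<close>

locale scaled_instance =
  fixes n l :: nat and p q :: "nat \<Rightarrow> nat" and cs :: "nat list"
begin

definition ws :: "nat list" where
  "ws = l # n # concat (map (\<lambda>i. [p i, q i]) [0..<n]) @ cs"

definition den :: "nat \<Rightarrow> nat" where
  "den e = (\<Prod>i<e. q i)"

definition val :: "nat \<Rightarrow> nat" where
  "val i = p i * (den n div q i)"

definition thr :: "nat \<Rightarrow> nat" where
  "thr j = (if j < n then val j else 0)"

text \<open>The word list in the simulated memory once e values have been replaced.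
  \<open>us j 0\<close> is the copied input without \<open>l\<close>, and \<open>us j n\<close> is
  the min-sum input of round j.\<close>

definition us :: "nat \<Rightarrow> nat \<Rightarrow> nat list" where
  "us j e = n # concat (map (\<lambda>i. [val i - thr j, 1]) [0..<e]) @
     concat (map (\<lambda>i. [p i, q i]) [e..<n]) @ cs"

abbreviation state :: "nat list \<Rightarrow> (nat \<Rightarrow> memory) \<Rightarrow> memory" where
  "state \<equiv> layout (Suc n) ws"

end

text \<open>\<open>f j\<close> stands for the final memory of the min-sum program in round j.
  Nothing is assumed about it here, so the objectives make sense even for meaningless
  outputs.\<close>

locale threshold_search = scaled_instance +
  fixes f :: "nat \<Rightarrow> memory"
begin

definition pot :: "nat \<Rightarrow> nat \<Rightarrow> nat" where
  "pot j e = l * thr j + (\<Sum>i<e. if 0 < f j (Suc i) then val i - thr j else 0)"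

text \<open>\<open>best j\<close> refers to the rounds before j. The value at 0 is merely the
  initial content of its variable, as it is for \<open>best_pot\<close>.\<close>

primrec best :: "nat \<Rightarrow> nat" where
  "best 0 = 0"
| "best (Suc j) = (if j = 0 \<or> pot j n < pot (best j) n then j else best j)"

definition best_pot :: "nat \<Rightarrow> nat" where
  "best_pot j = (if j = 0 then 0 else pot (best j) n)"

definition regions :: "nat \<Rightarrow> nat \<Rightarrow> memory" where
  "regions j = (\<lambda>i. if i < j then f i else (\<lambda>_. 0))"

end

text \<open>\<open>K\<close> bounds repetitions, both the passes of the loops within a round and the
  running time of \<open>c\<close>; \<open>B\<close> bounds lengths. With \<open>K \<le> B\<close>,
  the cells of \<open>c\<close> and all counters and indices fit into \<open>B\<close> as
  well.\<close>

locale bounded_threshold_search = threshold_search +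
  fixes c :: com and t :: "nat \<Rightarrow> nat" and B K :: nat
  assumes exec: "j \<le> n \<Longrightarrow> exec c (load_input (us j n)) (t j) (f j)"
    and time: "j \<le> n \<Longrightarrow> t j \<le> K"
    and K: "length ws + 2 \<le> K" "K \<le> B"
    and len_ws: "x \<in> set ws \<Longrightarrow> len x \<le> B"
    and len_den: "e \<le> n \<Longrightarrow> len (den e) \<le> B"
    and len_val: "i < n \<Longrightarrow> len (val i) \<le> B"
    and len_pot: "j \<le> n \<Longrightarrow> e \<le> n \<Longrightarrow> len (pot j e) \<le> B"
begin

lemma length_ws: "length ws = 2 + 2 * n + length cs"
  by (simp add: ws_def)

lemma length_us: "e \<le> n \<Longrightarrow> length (us j e) = length ws - 1"
  by (simp add: us_def ws_def)

lemma us_0: "us j 0 = tl ws"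
  by (simp add: us_def ws_def)

lemma us_Suc: "e < n \<Longrightarrow> (us j e)[Suc (2 * e) := val e - thr j, Suc (Suc (2 * e)) := 1] = us j (Suc e)"
  by (simp add: us_def upt_conv_Cons list_update_append)

lemma ws_nth:
  "i < n \<Longrightarrow> ws ! (2 + 2 * i) = p i"
  "i < n \<Longrightarrow> ws ! Suc (2 + 2 * i) = q i"
  by (simp_all add: ws_def nth_append nth_concat_pairs)

lemma state_1: "state xs R (Suc 0) = l"
  by (simp add: layout_Suc ws_def)

lemma len_small: "i \<le> Suc (length ws) \<Longrightarrow> len i \<le> B"
  using len_le[of i] K by linarith

lemma B_pos: "1 \<le> B" and K_pos: "1 \<le> K"
  using K by simp_all

lemma best_le: "best j \<le> j - 1"
  by (induction j) auto

lemma best_le_n: "j \<le> Suc n \<Longrightarrow> best j \<le> n"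
  using best_le[of j] by simp

lemma len_thr: "len (thr j) \<le> B"
  using len_val[of j] len_small[of 0] by (simp add: thr_def)

lemma len_best_pot: "j \<le> Suc n \<Longrightarrow> len (best_pot j) \<le> B"
  using len_pot[of "best j" n] best_le_n[of j] len_small[of 0] by (simp add: best_pot_def)

lemma len_nums: "i < n \<Longrightarrow> len (p i) \<le> B" and len_dens: "i < n \<Longrightarrow> len (q i) \<le> B"
  by (rule len_ws, force simp: ws_def)+

lemma bnd_us: "j \<le> n \<Longrightarrow> e \<le> n \<Longrightarrow> bnd B (load_input (us j e))"
proof (rule bnd_load_input)
  assume "j \<le> n" "e \<le> n"
  have "len (val i - thr j) \<le> B" if "i < n" for i
    using len_mono[of "val i - thr j" "val i"] len_val[OF that] by simp
  moreover have "len 1 \<le> B"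
    using len_small[of 1] by simp
  ultimately show "\<forall>x \<in> set (us j e). len x \<le> B"
    using len_ws len_nums len_dens \<open>e \<le> n\<close> by (auto simp: us_def ws_def)
  show "len (length (us j e)) \<le> B"
    using length_us[OF \<open>e \<le> n\<close>] by (simp add: len_small)
qed

lemma bnd_f: "j \<le> n \<Longrightarrow> bnd B (f j)"
  using bnd_exec[OF exec] time K bnd_us[of j n] le_trans by blast

lemma bnd_zero: "bnd B (\<lambda>_. 0)"
  using len_small[of 0] by (simp add: bnd_def)

lemma bnd_regions: "j \<le> Suc n \<Longrightarrow> bnd B (regions j i)"
  using bnd_f[of i] bnd_zero by (simp add: regions_def)

lemma bnd_state:
  assumes "length xs = 8" "\<forall>x \<in> set xs. len x \<le> B" "\<And>i. bnd B (R i)"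
  shows "bnd B (state xs R)"
  using assms len_ws by (intro bnd_layout) (auto intro: len_small)

lemma eval_num [simp]:
  "eval_exp e (state xs R) = i \<Longrightarrow> i < n \<Longrightarrow> eval_exp (num_exp e) (state xs R) = p i"
  using layout_Suc[of "2 + 2 * i" ws "Suc n" xs R] ws_nth(1)[of i] length_ws
  by (simp add: num_exp_def numeral_eq_Suc mult_2)

lemma eval_den [simp]:
  "eval_exp e (state xs R) = i \<Longrightarrow> i < n \<Longrightarrow> eval_exp (den_exp e) (state xs R) = q i"
  using layout_Suc[of "3 + 2 * i" ws "Suc n" xs R] ws_nth(2)[of i] length_ws
  by (simp add: den_exp_def numeral_eq_Suc mult_2)

lemma eval_val [simp]:
  "xs ! 2 = den n \<Longrightarrow> eval_exp e (state xs R) = i \<Longrightarrow> i < n \<Longrightarrow>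
     eval_exp (val_exp e) (state xs R) = val i"
  by (simp add: val_exp_def val_def)

lemma eval_count [simp]: "xs ! 0 = Suc n \<Longrightarrow> eval_exp count_exp (layout N vs xs R) = n"
  by (simp add: count_exp_def)

text \<open>The families \<open>V\<close>, \<open>X\<close> and \<open>R\<close> let the body change
  the input area, the variables or the simulated memories, and each kind of loop occurs. After the
  body the counter still reads i; only the appended \<open>incr 3\<close> advances it.\<close>

lemma runs_for_each:
  assumes body: "\<And>i. i < n \<Longrightarrow> runs B 1 d (layout (Suc n) (V i) ((X i)[3 := i]) (R i))
      (layout (Suc n) (V (Suc i)) ((X (Suc i))[3 := i]) (R (Suc i)))"
    and X: "\<And>i. i \<le> n \<Longrightarrow> length (X i) = 8 \<and> X i ! 0 = Suc n"
    and bnd: "\<And>i i'. i \<le> n \<Longrightarrow> i' \<le> n \<Longrightarrow> bnd B (layout (Suc n) (V i) ((X i)[3 := i']) (R i))"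
  shows "runs B K (for_each d) (layout (Suc n) (V 0) ((X 0)[3 := 0]) (R 0))
      (layout (Suc n) (V n) ((X n)[3 := 0]) (R n))"
proof -
  define S where "S i = layout (Suc n) (V i) ((X i)[3 := i]) (R i)" for i
  have "runs B 1 (Seq d (incr 3)) (S i) (S (Suc i))" if "i < n" for i
    unfolding incr_def S_def
    by (rule runs_Seq[OF body runs_Store_var]) (use that X[of "Suc i"] bnd in auto)
  then have "runs B (Suc n * 1) (While_Pos (Sub count_exp (Var 3)) (Seq d (incr 3))) (S 0) (S n)"
    by (intro runs_While) (use X bnd in \<open>auto simp: S_def\<close>)
  then have "runs B K (While_Pos (Sub count_exp (Var 3)) (Seq d (incr 3))) (S 0) (S n)"
    by (rule runs_mono) (use K length_ws in simp)
  moreover have "runs B K (Store (var_addr 3) (Const 0)) (S n) (layout (Suc n) (V n) ((X n)[3 := 0]) (R n))"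
    unfolding S_def by (rule runs_Store_var) (use K_pos X bnd in auto)
  ultimately show ?thesis
    unfolding for_each_def S_def by (rule runs_Seq)
qed

lemma load_input_ws: "load_input ws = state [0, 0, 0, 0, 0, 0, 0, 0] (regions 0)"
proof (rule ext)
  fix a
  have "replicate 8 0 ! i = (0::nat)" if "i < 8" for i
    using that by simp
  then show "load_input ws a = state [0, 0, 0, 0, 0, 0, 0, 0] (regions 0) a"
    by (auto simp: load_input_def layout_def regions_def numeral_eq_Suc)
qed

lemmas len_simps = len_small len_den len_val len_pot len_thr len_best_pot best_le_n

lemma den_Suc: "den (Suc e) = den e * q e"
  by (simp add: den_def)

lemma runs_prepare:
  "runs B K prepare (load_input ws) (state [Suc n, 0, den n, 0, 0, 0, 0, 0] (regions 0))"
proof -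
  define X where "X i = [Suc n, 0, den i, 0, 0, 0, 0, 0]" for i
  have bnd: "bnd B (state [a, 0, b, i, 0, 0, 0, 0] (regions 0))"
    if "a \<le> Suc n" "len b \<le> B" "i \<le> n" for a b i
    by (rule bnd_state) (use that length_ws in \<open>simp_all add: len_simps bnd_regions\<close>)
  have 1: "runs B K (Store (var_addr 0) (Add (Mem (Const 2)) (Const 1)))
      (state [0, 0, 0, 0, 0, 0, 0, 0] (regions 0)) (state [Suc n, 0, 0, 0, 0, 0, 0, 0] (regions 0))"
    by (rule runs_Store_var)
      (use K_pos bnd len_small[of 0] layout_Suc[of 1] length_ws in \<open>simp_all add: ws_def numeral_2_eq_2\<close>)
  have 2: "runs B K (Store (var_addr 2) (Const 1)) (state [Suc n, 0, 0, 0, 0, 0, 0, 0] (regions 0))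
      (state ((X 0)[3 := 0]) (regions 0))"
    by (rule runs_Store_var) (use K_pos bnd len_small[of 0] in \<open>simp_all add: X_def den_def\<close>)
  have 3: "runs B K (for_each (Store (var_addr 2) (Mul (Var 2) (den_exp (Var 3)))))
      (state ((X 0)[3 := 0]) (regions 0)) (state ((X n)[3 := 0]) (regions 0))"
  proof (rule runs_for_each)
    fix i assume "i < n"
    then show "runs B 1 (Store (var_addr 2) (Mul (Var 2) (den_exp (Var 3))))
        (state ((X i)[3 := i]) (regions 0)) (state ((X (Suc i))[3 := i]) (regions 0))"
      by (intro runs_Store_var) (simp_all add: bnd X_def len_den den_Suc)
  qed (simp_all add: X_def bnd len_den)
  show ?thesis
    unfolding prepare_def load_input_ws
    using runs_Seq[OF 1 runs_Seq[OF 2 3]] by (simp add: X_def)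
qed

lemma bnd_round:
  assumes "j \<le> n" "i \<le> length ws" "len w \<le> B" "len v \<le> B" "len b \<le> B" "len bc \<le> B" "bnd B r"
  shows "bnd B (state [Suc n, j, den n, i, w, v, b, bc] ((regions j)(j := r)))"
  using assms length_ws by (intro bnd_state) (auto simp: len_simps bnd_regions)

section \<open>A single round\<close>

context
  fixes j
  assumes j: "j \<le> n"
begin

lemma len_best: "len (best j) \<le> B" "len (best_pot j) \<le> B" "len j \<le> B"
proof -
  have "best j \<le> n" using best_le_n j by simp
  then show "len (best j) \<le> B" "len (best_pot j) \<le> B" "len j \<le> B"
    using j length_ws by (simp_all add: len_small len_best_pot)
qed

abbreviation round :: "nat \<Rightarrow> nat \<Rightarrow> nat \<Rightarrow> memory \<Rightarrow> memory" where
  "round i w v r \<equiv> state [Suc n, j, den n, i, w, v, best j, best_pot j] ((regions j)(j := r))"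

lemma bnd_round': "i \<le> length ws \<Longrightarrow> len w \<le> B \<Longrightarrow> len v \<le> B \<Longrightarrow> bnd B r \<Longrightarrow> bnd B (round i w v r)"
  using bnd_round j len_best by blast

lemma runs_set_threshold:
  "runs B K set_threshold (round 0 0 0 (\<lambda>_. 0)) (round 0 (thr j) 0 (\<lambda>_. 0))"
proof (cases "j < n")
  case True
  show ?thesis
    unfolding set_threshold_def
    by (rule runs_If_True[OF _ _ runs_Store_var])
      (use True K_pos in \<open>simp_all add: bnd_round' bnd_zero len_small thr_def\<close>)
next
  case False
  show ?thesis
    unfolding set_threshold_def
    by (rule runs_If_False[OF _ _ runs_Store_var])
      (use False K_pos in \<open>simp_all add: bnd_round' bnd_zero len_small thr_def\<close>)
qed

lemma runs_copy_input:
  "runs B K copy_input (round 0 (thr j) 0 (\<lambda>_. 0)) (round 0 (thr j) 0 (load_input (us j 0)))"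
proof -
  define m where "m = length ws - 1"
  \<comment> \<open>The simulated memory after its length cell and i entries have been written; m is
    the length of the word list passed to \<open>c\<close>.\<close>
  define r where "r i = (\<lambda>a. if a < Suc i then (m # tl ws) ! a else 0)" for i
  have m: "length ws = Suc m" "length (tl ws) = m"
    using length_ws by (simp_all add: m_def)
  have bnd_r: "bnd B (r i)" if "i \<le> m" for i
  proof -
    have "len ((m # tl ws) ! a) \<le> B" if "a < Suc m" for a
    proof -
      have "(m # tl ws) ! a \<in> set (m # tl ws)"
        using that m by (intro nth_mem) simp
      then show ?thesis
        using m(1) list.set_sel(2)[of ws] len_small[of m] len_ws by (cases ws) auto
    qed
    then show ?thesis
      using that len_small[of 0] by (simp add: bnd_def r_def)
  qed
  note b = bnd_round'[OF _ len_thr _ bnd_r] bnd_round'[OF _ len_thr _ bnd_zero]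
  have 1: "runs B K (Store (cell_addr (Const 0)) (Sub (Mem (Const 0)) (Const 1)))
      (round 0 (thr j) 0 (\<lambda>_. 0)) (round 0 (thr j) 0 (r 0))"
    by (rule runs_Store_cell[of _ _ _ _ _ _ j])
      (use K_pos j m in \<open>auto simp: b len_small r_def fun_eq_iff\<close>)
  define S where "S i = round i (thr j) 0 (r i)" for i
  have "runs B 1 (Seq (Store (cell_addr (Add (Var 3) (Const 1))) (Mem (Add (Var 3) (Const 2)))) (incr 3))
      (S i) (S (Suc i))" if i: "i < m" for i
  proof (rule runs_Seq)
    have "r (Suc i) = (r i)(Suc i := tl ws ! i)"
      by (auto simp: r_def fun_eq_iff less_Suc_eq nth_Cons split: nat.splits)
    moreover have "state xs R (Suc (Suc i)) = tl ws ! i" for xs R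
      using i m by (simp add: layout_Suc nth_tl)
    ultimately show "runs B 1 (Store (cell_addr (Add (Var 3) (Const 1))) (Mem (Add (Var 3) (Const 2)))) (S i)
        (round i (thr j) 0 (r (Suc i)))"
      unfolding S_def using i m j by (intro runs_Store_cell[of _ _ _ _ _ _ j]) (simp_all add: b len_small)
    show "runs B 1 (incr 3) (round i (thr j) 0 (r (Suc i))) (S (Suc i))"
      unfolding S_def incr_def using i m by (intro runs_Store_var) (simp_all add: b len_small)
  qed
  then have "runs B (Suc m * 1) (While_Pos (Sub (Mem (Const 0)) (Add (Var 3) (Const 1)))
     (Seq (Store (cell_addr (Add (Var 3) (Const 1))) (Mem (Add (Var 3) (Const 2)))) (incr 3))) (S 0) (S m)"
    by (intro runs_While) (use m in \<open>simp_all add: S_def b len_small\<close>)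
  then have 2: "runs B K (While_Pos (Sub (Mem (Const 0)) (Add (Var 3) (Const 1)))
     (Seq (Store (cell_addr (Add (Var 3) (Const 1))) (Mem (Add (Var 3) (Const 2)))) (incr 3))) (S 0) (S m)"
    by (rule runs_mono) (use K m in simp)
  have rm: "r m = load_input (us j 0)"
    using m by (auto simp: r_def load_input_def us_0)
  have 3: "runs B K (Store (var_addr 3) (Const 0)) (S m) (round 0 (thr j) 0 (load_input (us j 0)))"
    unfolding S_def rm[symmetric] using K_pos m by (intro runs_Store_var) (simp_all add: b len_small)
  show ?thesis
    unfolding copy_input_def using runs_Seq[OF 1 runs_Seq[OF 2[unfolded S_def] 3[unfolded S_def]]] by simp
qed

lemma len_diff: "i < n \<Longrightarrow> len (val i - thr j) \<le> B"
  using len_mono[of "val i - thr j" "val i"] len_val[of i] by simp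

lemma runs_shift_values:
  "runs B K shift_values (round 0 (thr j) 0 (load_input (us j 0))) (round 0 (thr j) 0 (load_input (us j n)))"
proof -
  define X where "X = [Suc n, j, den n, 0, thr j, 0, best j, best_pot j]"
  have X: "X[3 := i] = [Suc n, j, den n, i, thr j, 0, best j, best_pot j]" for i
    by (simp add: X_def)
  have b: "bnd B (round i (thr j) 0 (load_input (us j e)))" if "i \<le> n" "e \<le> n" for i e
    using that j length_ws by (intro bnd_round') (simp_all add: len_thr len_small bnd_us)
  have "runs B K shift_values (state (X[3 := 0]) ((regions j)(j := load_input (us j 0))))
      (state (X[3 := 0]) ((regions j)(j := load_input (us j n))))"
    unfolding shift_values_def
  proof (rule runs_for_each[where X = "\<lambda>_. X" and R = "\<lambda>i. (regions j)(j := load_input (us j i))"])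
    fix i assume i: "i < n"
    \<comment> \<open>The word list between the two stores: the numerator is new, the denominator is
      still the copied one.\<close>
    let ?u = "(us j i)[Suc (2 * i) := val i - thr j]"
    have len: "2 * i + 2 < length (us j i)"
      using i length_us[of i j] length_ws by simp
    have up: "(load_input (us j i))(Suc (Suc (i + i)) := val i - thr j) = load_input ?u"
      "(load_input ?u)(Suc (Suc (Suc (i + i))) := Suc 0) = load_input (us j (Suc i))"
      using len i by (simp_all add: load_input_update us_Suc[symmetric] mult_2)
    have "bnd B ((load_input (us j i))(Suc (Suc (i + i)) := val i - thr j))"
      using bnd_us[of j i] j i len_diff[OF i] by (simp add: bnd_def)
    then have bu: "bnd B (round i (thr j) 0 (load_input ?u))"
      using i length_ws unfolding up(1) by (intro bnd_round') (simp_all add: len_thr len_small)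
    show "runs B 1 (Seq (Store (cell_addr (Add (Const 2) (Add (Var 3) (Var 3)))) (Sub (val_exp (Var 3)) (Var 4)))
          (Store (cell_addr (Add (Const 3) (Add (Var 3) (Var 3)))) (Const 1)))
        (state (X[3 := i]) ((regions j)(j := load_input (us j i))))
        (state (X[3 := i]) ((regions j)(j := load_input (us j (Suc i)))))"
    proof (rule runs_Seq)
      show "runs B 1 (Store (cell_addr (Add (Const 2) (Add (Var 3) (Var 3)))) (Sub (val_exp (Var 3)) (Var 4)))
          (state (X[3 := i]) ((regions j)(j := load_input (us j i))))
          (round i (thr j) 0 (load_input ?u))"
        unfolding X by (rule runs_Store_cell[of _ _ _ _ _ _ j]) (use i j b in \<open>simp_all add: up(1)[symmetric]\<close>)
      show "runs B 1 (Store (cell_addr (Add (Const 3) (Add (Var 3) (Var 3)))) (Const 1))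
          (round i (thr j) 0 (load_input ?u))
          (state (X[3 := i]) ((regions j)(j := load_input (us j (Suc i)))))"
        unfolding X by (rule runs_Store_cell[of _ _ _ _ _ _ j]) (use i j bu in \<open>simp_all add: up(2)[symmetric] numeral_3_eq_3\<close>)
    qed
  qed (use b in \<open>simp_all add: X_def\<close>)
  then show ?thesis by (simp add: X)
qed

lemma runs_sim_round:
  "runs B K (sim c) (round 0 (thr j) 0 (load_input (us j n))) (round 0 (thr j) 0 (f j))"
proof (rule runs_mono[OF runs_sim])
  show "exec c (load_input (us j n)) (t j) (f j)" "t j \<le> K" "t j \<le> B" "bnd B (load_input (us j n))"
    using exec[OF j] time[OF j] K bnd_us[OF j] by simp_all
qed (use j in \<open>simp_all add: bnd_round' len_small len_thr\<close>)

lemma pot_Suc: "pot i (Suc e) = pot i e + (if 0 < f i (Suc e) then val e - thr i else 0)"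
  by (simp add: pot_def)

lemma runs_evaluate:
  "runs B K evaluate (round 0 (thr j) 0 (f j)) (round 0 (thr j) (pot j n) (f j))"
proof -
  define X where "X i = [Suc n, j, den n, 0, thr j, pot j i, best j, best_pot j]" for i :: nat
  have b: "bnd B (round i (thr j) (pot j e) (f j))" if "i \<le> n" "e \<le> n" for i e
    using that j length_ws by (intro bnd_round') (simp_all add: len_thr len_small len_pot bnd_f)
  have 1: "runs B K (Store (var_addr 5) (Mul (Mem (Const 1)) (Var 4)))
      (round 0 (thr j) 0 (f j)) (state ((X 0)[3 := 0]) ((regions j)(j := f j)))"
    by (rule runs_Store_var)
      (use K_pos j bnd_f state_1 in \<open>simp_all add: X_def pot_def bnd_round' len_thr len_small\<close>)
  have 2: "runs B K (for_each (If_Pos (Cell (Add (Var 3) (Const 1)))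
       (Store (var_addr 5) (Add (Var 5) (Sub (val_exp (Var 3)) (Var 4)))) Skip))
       (state ((X 0)[3 := 0]) ((regions j)(j := f j))) (state ((X n)[3 := 0]) ((regions j)(j := f j)))"
  proof (rule runs_for_each[where R = "\<lambda>i. (regions j)(j := f j)"])
    fix i assume i: "i < n"
    show "runs B 1 (If_Pos (Cell (Add (Var 3) (Const 1)))
          (Store (var_addr 5) (Add (Var 5) (Sub (val_exp (Var 3)) (Var 4)))) Skip)
        (state ((X i)[3 := i]) ((regions j)(j := f j)))
        (state ((X (Suc i))[3 := i]) ((regions j)(j := f j)))"
    proof (cases "0 < f j (Suc i)")
      case True
      show ?thesis
        by (rule runs_If_True[OF _ _ runs_Store_var])
          (use True i j b in \<open>simp_all add: X_def pot_Suc\<close>)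
    next
      case False
      then have "X (Suc i) = X i"
        by (simp add: X_def pot_Suc)
      then show ?thesis
        using False i j b by (intro runs_If_False) (auto simp: X_def intro: runs_Skip B_pos)
    qed
  qed (use b in \<open>simp_all add: X_def\<close>)
  show ?thesis
    unfolding evaluate_def using runs_Seq[OF 1 2] by (simp add: X_def)
qed

lemma runs_finish_round:
  "runs B K (Seq keep_best next_round) (round 0 (thr j) (pot j n) (f j))
     (state [Suc n, Suc j, den n, 0, 0, 0, best (Suc j), best_pot (Suc j)] (regions (Suc j)))"
proof -
  let ?s = "\<lambda>i w v. state [Suc n, i, den n, 0, w, v, best (Suc j), best_pot (Suc j)] ((regions j)(j := f j))"
  have b: "bnd B (state [Suc n, j, den n, 0, w, v, b, bc] ((regions j)(j := f j)))"
    if "len w \<le> B" "len v \<le> B" "len b \<le> B" "len bc \<le> B" for w v b bc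
    using that j bnd_f by (intro bnd_round) simp_all
  have best': "len (best (Suc j)) \<le> B" "len (best_pot (Suc j)) \<le> B"
    using j best_le_n[of "Suc j"] length_ws by (simp_all add: len_small len_best_pot del: best.simps)
  have 1: "runs B K keep_best (round 0 (thr j) (pot j n) (f j)) (?s j (thr j) (pot j n))"
  proof (cases "j = 0 \<or> pot j n < pot (best j) n")
    case True
    then have best: "best (Suc j) = j" "best_pot (Suc j) = pot j n"
      by (auto simp: best_pot_def)
    have "runs B K (Seq (Store (var_addr 7) (Var 5)) (Store (var_addr 6) (Var 1)))
        (round 0 (thr j) (pot j n) (f j)) (?s j (thr j) (pot j n))"
      unfolding best
      by (rule runs_Seq[OF runs_Store_var[of _ _ _ _ _ _ _ "[Suc n, j, den n, 0, thr j, pot j n, best j, pot j n]"]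
              runs_Store_var])
        (use K_pos j in \<open>simp_all add: b len_thr len_pot len_best\<close>)
    moreover have "0 < eval_exp (Add (Sub (Const 1) (Var 1)) (Sub (Var 7) (Var 5))) (round 0 (thr j) (pot j n) (f j))"
      using True by (auto simp: best_pot_def)
    ultimately show ?thesis
      unfolding keep_best_def
      by (intro runs_If_True) (use K_pos j in \<open>simp_all add: b len_thr len_pot len_best del: best.simps\<close>)
  next
    case False
    then have best: "best (Suc j) = best j" "best_pot (Suc j) = best_pot j"
      by (auto simp: best_pot_def)
    have "eval_exp (Add (Sub (Const 1) (Var 1)) (Sub (Var 7) (Var 5))) (round 0 (thr j) (pot j n) (f j)) = 0"
      using False by (auto simp: best_pot_def)
    then show ?thesis
      unfolding keep_best_def best using K_pos B_pos j
      by (intro runs_If_False runs_Skip) (simp_all add: b len_thr len_pot len_best)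
  qed
  have 2: "runs B K next_round (?s j (thr j) (pot j n)) (?s (Suc j) 0 0)"
    unfolding next_round_def incr_def
    by (rule runs_Seq[OF runs_Store_var[of _ _ _ _ _ _ _ "[Suc n, j, den n, 0, 0, pot j n, best (Suc j), best_pot (Suc j)]"]
          runs_Seq[OF runs_Store_var[of _ _ _ _ _ _ _ "[Suc n, j, den n, 0, 0, 0, best (Suc j), best_pot (Suc j)]"]
          runs_Store_var]])
      (use K_pos j in \<open>simp_all add: b len_thr len_pot best' len_small del: best.simps\<close>)
  have "(regions j)(j := f j) = regions (Suc j)"
    by (auto simp: regions_def)
  with runs_Seq[OF 1 2] show ?thesis by simp
qed

lemma runs_round:
  "runs B K (search_round c)
     (state [Suc n, j, den n, 0, 0, 0, best j, best_pot j] (regions j))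
     (state [Suc n, Suc j, den n, 0, 0, 0, best (Suc j), best_pot (Suc j)] (regions (Suc j)))"
proof -
  have "(regions j)(j := \<lambda>_. 0) = regions j"
    by (auto simp: regions_def)
  then show ?thesis
    unfolding search_round_def
    using runs_Seq[OF runs_set_threshold runs_Seq[OF runs_copy_input runs_Seq[OF runs_shift_values
      runs_Seq[OF runs_sim_round runs_Seq[OF runs_evaluate runs_finish_round]]]]]
    by (simp del: best.simps)
qed

end

section \<open>All rounds and the output\<close>

lemma runs_rounds:
  "runs B (Suc (Suc n) * K) (While_Pos (Sub (Var 0) (Var 1)) (search_round c))
     (state [Suc n, 0, den n, 0, 0, 0, 0, 0] (regions 0))
     (state [Suc n, Suc n, den n, 0, 0, 0, best (Suc n), best_pot (Suc n)] (regions (Suc n)))"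
proof -
  define S where "S j = state [Suc n, j, den n, 0, 0, 0, best j, best_pot j] (regions j)" for j
  have "bnd B (S j)" if "j \<le> Suc n" for j
    unfolding S_def using that best_le_n[OF that] length_ws
    by (intro bnd_state) (simp_all add: len_small len_den len_best_pot bnd_regions)
  then have "runs B (Suc (Suc n) * K) (While_Pos (Sub (Var 0) (Var 1)) (search_round c)) (S 0) (S (Suc n))"
    using runs_round K_pos by (intro runs_While) (simp_all add: S_def del: best.simps)
  then show ?thesis
    by (simp add: S_def best_pot_def[of 0] del: best.simps(2))
qed

lemma runs_write_output:
  "\<exists>s. runs B K write_output
       (state [Suc n, Suc n, den n, 0, 0, 0, best (Suc n), best_pot (Suc n)] (regions (Suc n))) s \<and>
     read_output s = map (f (best (Suc n))) [1..<Suc n]"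
proof -
  define b where "b = best (Suc n)"
  have b: "b \<le> n"
    unfolding b_def by (rule best_le_n) simp
  have reg: "regions (Suc n) b = f b"
    using b by (simp add: regions_def)
  \<comment> \<open>The output grows over the input from the left. It has n entries and the input
    more than 2 * n, so no variable is hit.\<close>
  define V where "V i = map (\<lambda>i. f b (Suc i)) [0..<i] @ drop i ws" for i
  define X where "X = [Suc n, b, den n, 0, 0, 0, b, best_pot (Suc n)]"
  have length_V: "i \<le> n \<Longrightarrow> length (V i) = length ws" for i
    using length_ws by (simp add: V_def)
  have "len x \<le> B" if "x \<in> set (V i)" for x i
    using that bnd_f[OF b] by (auto simp: V_def bnd_def intro: len_ws dest: in_set_dropD)
  then have bnd: "bnd B (layout (Suc n) (V i) [Suc n, a, den n, i', 0, 0, b, best_pot (Suc n)] (regions (Suc n)))"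
    if "i \<le> n" "i' \<le> n" "a \<le> Suc n" for i i' a
    using that b length_ws length_V
    by (intro bnd_layout) (auto simp: len_small len_den len_best_pot bnd_regions)
  have 1: "runs B K (Store (var_addr 1) (Var 6))
      (state [Suc n, Suc n, den n, 0, 0, 0, b, best_pot (Suc n)] (regions (Suc n)))
      (layout (Suc n) (V 0) (X[3 := 0]) (regions (Suc n)))"
    using bnd[of 0] K_pos by (simp add: V_def X_def) (rule runs_Store_var, simp_all)
  have 2: "runs B K (for_each (Store (Add (Var 3) (Const 1)) (Cell (Add (Var 3) (Const 1)))))
      (layout (Suc n) (V 0) (X[3 := 0]) (regions (Suc n)))
      (layout (Suc n) (V n) (X[3 := 0]) (regions (Suc n)))"
  proof (rule runs_for_each[where X = "\<lambda>_. X" and R = "\<lambda>i. regions (Suc n)"])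
    fix i assume i: "i < n"
    have "V (Suc i) = (V i)[i := f b (Suc i)]"
      using i length_ws by (simp add: V_def list_update_append Cons_nth_drop_Suc[symmetric])
    then show "runs B 1 (Store (Add (Var 3) (Const 1)) (Cell (Add (Var 3) (Const 1))))
        (layout (Suc n) (V i) (X[3 := i]) (regions (Suc n)))
        (layout (Suc n) (V (Suc i)) (X[3 := i]) (regions (Suc n)))"
      using i b length_ws length_V[of i]
      by (intro runs_Store_input[of _ _ _ _ _ _ _ i]) (simp_all add: X_def bnd reg)
  qed (use b in \<open>simp_all add: X_def bnd\<close>)
  define s where "s = layout (Suc n) (V n) (X[3 := 0]) (regions (Suc n))"
  \<comment> \<open>Cell 0 ceases to hold the input length here, so the result is given as a plain
    update of s.\<close>
  have 3: "runs B K (Store (Const 0) count_exp) s (s(0 := n))"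
    using K_pos b by (intro runs_Store) (simp_all add: s_def X_def bnd)
  have "s (Suc i) = f b (Suc i)" if "i < n" for i
    using that length_V[of n] length_ws layout_Suc[of i "V n" "Suc n" "X[3 := 0]" "regions (Suc n)"]
    by (simp add: s_def V_def nth_append)
  then have "s a = f b a" if "1 \<le> a" "a \<le> n" for a
    using that by (cases a) simp_all
  then have "read_output (s(0 := n)) = map (f b) [1..<Suc n]"
    by (auto simp: read_output_def simp del: upt_Suc)
  then show ?thesis
    unfolding write_output_def b_def[symmetric]
    using runs_Seq[OF 1 runs_Seq[OF 2 3[unfolded s_def]]] unfolding s_def by blast
qed

lemma runs_search:
  "\<exists>s. runs B (Suc (Suc n) * K) (search c) (load_input ws) s \<and>
     read_output s = map (f (best (Suc n))) [1..<Suc n]"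
proof -
  have "K \<le> Suc (Suc n) * K" by simp
  with runs_write_output runs_Seq[OF runs_mono[OF runs_prepare] runs_Seq[OF runs_rounds runs_mono]]
  show ?thesis
    unfolding search_def by blast
qed

lemma pot_best_le: "i < j \<Longrightarrow> pot (best j) n \<le> pot i n"
  by (induction j) (auto simp: less_Suc_eq)

end

section \<open>Choosing the threshold\<close>

text \<open>An element outside S has entry 0, whose positive part above a nonnegative threshold
  vanishes.\<close>

lemma sum_restrict_vec:
  assumes "distinct g" "S \<subseteq> set g" "0 \<le> w"
  shows "(\<Sum>x\<leftarrow>map (restrict_vec v S) g. max 0 (x - w)) = (\<Sum>x\<in>S. max 0 (v x - w))"
proof -
  have "(\<Sum>x\<leftarrow>map (restrict_vec v S) g. max 0 (x - w)) = (\<Sum>x\<in>set g. max 0 (restrict_vec v S x - w))"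
    using assms(1) by (simp add: sum_list_distinct_conv_sum_set o_def)
  also have "\<dots> = (\<Sum>x\<in>S. max 0 (restrict_vec v S x - w))"
    using assms(2,3) by (intro sum.mono_neutral_right) (auto simp: restrict_vec_def)
  also have "\<dots> = (\<Sum>x\<in>S. max 0 (v x - w))"
    by (intro sum.cong) (auto simp: restrict_vec_def)
  finally show ?thesis .
qed

lemma threshold_approximation:
  fixes \<alpha> :: real and v :: "'e \<Rightarrow> rat" and w :: "nat \<Rightarrow> rat"
    and g :: "'e list" and l :: nat
    and top_val :: "'e set \<Rightarrow> rat" and excess :: "nat \<Rightarrow> 'e set \<Rightarrow> rat"
  defines "top_val \<equiv> \<lambda>S. top_sum l (map (restrict_vec v S) g)"
  defines "excess \<equiv> \<lambda>j S. \<Sum>x\<in>S. max 0 (v x - w j)"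
  assumes g: "distinct g" "F \<subseteq> Pow (set g)" "\<forall>x \<in> set g. 0 \<le> v x"
    and "1 \<le> \<alpha>"
    and w: "insert 0 (v ` set g) \<subseteq> w ` {..n}" "\<forall>j \<le> n. 0 \<le> w j"
    and Sol: "\<forall>j \<le> n. Sol j \<in> F"
    and approx: "\<forall>j \<le> n. \<forall>S \<in> F. real_of_rat (excess j (Sol j)) \<le> \<alpha> * real_of_rat (excess j S)"
    and b: "b \<le> n"
      "\<forall>j \<le> n. of_nat l * w b + excess b (Sol b) \<le> of_nat l * w j + excess j (Sol j)"
    and S: "S \<in> F"
  shows "real_of_rat (top_val (Sol b)) \<le> \<alpha> * real_of_rat (top_val S)"
proof (cases "l = 0")
  case True
  then show ?thesis by (simp add: top_val_def top_sum_def)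
next
  case False
  have nonneg: "\<forall>x \<in> set (map (restrict_vec v S') g). 0 \<le> x" for S'
    using g(3) by (auto simp: restrict_vec_def)
  have "Sol b \<subseteq> set g" "S \<subseteq> set g"
    using g(2) Sol b(1) S by auto
  have "\<exists>u \<in> insert 0 (set (map (restrict_vec v S) g)).
      top_val S = of_nat l * u + (\<Sum>x\<leftarrow>map (restrict_vec v S) g. max 0 (x - u))"
    unfolding top_val_def using top_sum_eq_threshold[OF nonneg, of l S] False by simp
  then obtain u where u: "u \<in> insert 0 (set (map (restrict_vec v S) g))"
    "top_val S = of_nat l * u + (\<Sum>x\<leftarrow>map (restrict_vec v S) g. max 0 (x - u))"
    by blast
  \<comment> \<open>An entry of the restricted vector is a value of v or 0, so the tight threshold
    is among the candidates although S is unknown to the program.\<close>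
  have "u \<in> insert 0 (v ` set g)"
    using u(1) by (auto simp: restrict_vec_def)
  then obtain j where j: "j \<le> n" "u = w j"
    using w(1) by (metis (no_types, lifting) atMost_iff imageE subsetD)
  have top_S: "top_val S = of_nat l * w j + excess j S"
    unfolding u(2) j(2) excess_def using sum_restrict_vec[OF g(1) \<open>S \<subseteq> set g\<close>] w(2) j(1) by simp
  have "top_val (Sol b) \<le> of_nat l * w b + excess b (Sol b)"
    unfolding top_val_def excess_def using top_sum_le_threshold[OF nonneg, of "w b" l "Sol b"] w(2) b(1)
      sum_restrict_vec[OF g(1) \<open>Sol b \<subseteq> set g\<close>, of "w b"] by simp
  also have "\<dots> \<le> of_nat l * w j + excess j (Sol j)"
    using b(2) j(1) by blast
  finally have "real_of_rat (top_val (Sol b)) \<le> real l * real_of_rat (w j) + real_of_rat (excess j (Sol j))"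
    by (metis of_rat_add of_rat_less_eq of_rat_mult of_rat_of_nat_eq)
  \<comment> \<open>The threshold term is not approximated; as it is nonnegative, \<alpha> \<ge> 1
    allows it to be multiplied by \<alpha> too.\<close>
  also have "\<dots> \<le> \<alpha> * (real l * real_of_rat (w j)) + \<alpha> * real_of_rat (excess j S)"
    using approx j(1) S w(2) \<open>1 \<le> \<alpha>\<close> mult_right_mono[of 1 \<alpha> "real l * real_of_rat (w j)"]
    by (intro add_mono) auto
  also have "\<dots> = \<alpha> * real_of_rat (top_val S)"
    unfolding top_S by (simp add: of_rat_add of_rat_mult distrib_left)
  finally show ?thesis .
qed

section \<open>Polynomial bounds\<close>

text \<open>From w = 2 on, a pure power absorbs constants and sums, so no coefficients have to be
  carried along.\<close>

definition poly_bounded :: "(nat \<Rightarrow> nat) \<Rightarrow> bool" where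
  "poly_bounded h \<longleftrightarrow> (\<exists>k. \<forall>w \<ge> 2. h w \<le> w ^ k)"

named_theorems poly_bounded_intros

lemma poly_bounded_const [poly_bounded_intros]: "poly_bounded (\<lambda>w. a)"
proof -
  have "a \<le> w ^ a" if "2 \<le> w" for w :: nat
    using that less_exp[of a] power_mono[of 2 w a] by simp
  then show ?thesis
    unfolding poly_bounded_def by blast
qed

lemma poly_bounded_id [poly_bounded_intros]: "poly_bounded (\<lambda>w. w)"
  unfolding poly_bounded_def by (intro exI[of _ 1]) simp

lemma poly_bounded_mult [poly_bounded_intros]:
  assumes "poly_bounded h" "poly_bounded h'"
  shows "poly_bounded (\<lambda>w. h w * h' w)"
proof -
  obtain k k' where "\<forall>w \<ge> 2. h w \<le> w ^ k" "\<forall>w \<ge> 2. h' w \<le> w ^ k'"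
    using assms unfolding poly_bounded_def by blast
  then show ?thesis
    unfolding poly_bounded_def by (intro exI[of _ "k + k'"]) (simp add: power_add mult_le_mono)
qed

lemma poly_bounded_add [poly_bounded_intros]:
  assumes "poly_bounded h" "poly_bounded h'"
  shows "poly_bounded (\<lambda>w. h w + h' w)"
proof -
  obtain k k' where k: "\<forall>w \<ge> 2. h w \<le> w ^ k" "\<forall>w \<ge> 2. h' w \<le> w ^ k'"
    using assms unfolding poly_bounded_def by blast
  have "h w + h' w \<le> w ^ Suc (k + k')" if "2 \<le> w" for w
  proof -
    have "w ^ k \<le> w ^ (k + k')" "w ^ k' \<le> w ^ (k + k')"
      using that by (auto intro: power_increasing)
    then have "h w + h' w \<le> 2 * w ^ (k + k')"
      using k that by (metis add_mono le_trans mult_2)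
    also have "\<dots> \<le> w ^ Suc (k + k')"
      using that by simp
    finally show ?thesis .
  qed
  then show ?thesis
    unfolding poly_bounded_def by blast
qed

lemma poly_bounded_power [poly_bounded_intros]: "poly_bounded h \<Longrightarrow> poly_bounded (\<lambda>w. h w ^ d)"
  by (induction d) (simp_all add: poly_bounded_const poly_bounded_mult)

lemma poly_boundedD:
  assumes "poly_bounded h"
  shows "\<exists>k. \<forall>w \<ge> 2. h w \<le> k * w ^ k + k"
proof -
  obtain k where k: "\<forall>w \<ge> 2. h w \<le> w ^ k"
    using assms unfolding poly_bounded_def by blast
  \<comment> \<open>The exponent is raised because for k = 0 the required bound would be 0.\<close>
  have "h w \<le> Suc k * w ^ Suc k + Suc k" if "2 \<le> w" for w
  proof -
    have "h w \<le> w ^ Suc k"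
      using k that power_increasing[of k "Suc k" w] by (metis Suc_1 Suc_leD le_SucI le_trans order_refl)
    then show ?thesis by simp
  qed
  then show ?thesis by blast
qed

lemma length_le_word_size: "length xs \<le> word_size xs"
proof (induction xs)
  case (Cons x xs)
  then show ?case using len_ge_1[of x] by (simp add: word_size_def)
qed simp

lemma len_le_word_size: "x \<in> set xs \<Longrightarrow> len x \<le> word_size xs"
  unfolding word_size_def by (rule member_le_sum_list) simp_all

text \<open>Lengths add up under multiplication; the 2 is the length of the empty product 1.\<close>

lemma len_prod:
  fixes h :: "nat \<Rightarrow> nat" and e :: nat
  shows "len (\<Prod>i<e. h i) \<le> 2 + (\<Sum>i<e. len (h i))"
proof (induction e)
  case 0
  then show ?case using len_le[of 1] by simp
next
  case (Suc e)
  then show ?case using len_mult[of "\<Prod>i<e. h i" "h e"] by simp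
qed

lemma len_sum:
  fixes h :: "nat \<Rightarrow> nat" and e :: nat
  shows "len (\<Sum>i<e. h i) \<le> 1 + (\<Sum>i<e. len (h i))"
proof (induction e)
  case 0
  then show ?case using len_le[of 0] by simp
next
  case (Suc e)
  then show ?case using len_add[of "\<Sum>i<e. h i" "h e"] by simp
qed

lemma word_size_simps [simp]:
  "word_size [] = 0" "word_size (x # xs) = len x + word_size xs"
  "word_size (xs @ ys) = word_size xs + word_size ys"
  by (simp_all add: word_size_def)

lemma word_size_concat_pairs:
  "word_size (concat (map (\<lambda>i. [a i, b i]) [0..<m])) = (\<Sum>i<m. len (a i) + len (b i))"
  by (induction m) simp_all

context scaled_instance
begin

lemma word_size_ws: "word_size ws = len l + len n + (\<Sum>i<n. len (p i) + len (q i)) + word_size cs"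
  by (simp add: ws_def word_size_concat_pairs)

lemma n_le_word_size: "n \<le> word_size ws"
  using length_le_word_size[of ws] by (simp add: ws_def)

text \<open>The common denominator may be exponentially large, but its length is at most the total
  length of the denominators plus 2.\<close>

lemma len_den_le: "e \<le> n \<Longrightarrow> len (den e) \<le> word_size ws + 2"
proof -
  assume "e \<le> n"
  have "(\<Sum>i<e. len (q i)) \<le> (\<Sum>i<n. len (q i))"
    using \<open>e \<le> n\<close> by (intro sum_mono2) auto
  then show ?thesis
    using len_prod[of q e] by (simp add: den_def word_size_ws sum.distrib)
qed

lemma len_val_le: "i < n \<Longrightarrow> len (val i) \<le> 2 * word_size ws + 2"
proof -
  assume "i < n"
  then have "p i \<in> set ws"
    by (force simp: ws_def)
  then show ?thesis
    using len_mult[of "p i" "den n div q i"] len_mono[of "den n div q i" "den n"] len_den_le[of n]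
      len_le_word_size[of "p i" ws] by (simp add: val_def)
qed

lemma len_thr_le: "len (thr j) \<le> 2 * word_size ws + 2"
  using len_val_le[of j] len_le[of 0] by (simp add: thr_def)

lemma word_size_us_le: "word_size (us j n) \<le> word_size ws + word_size ws * (2 * word_size ws + 4)"
proof -
  have "len (val i - thr j) + len 1 \<le> 2 * word_size ws + 4" if "i < n" for i
    using len_val_le[OF that] len_mono[of "val i - thr j" "val i"] len_le[of 1] by simp
  then have "(\<Sum>i<n. len (val i - thr j) + len 1) \<le> n * (2 * word_size ws + 4)"
    using sum_bounded_above[of "{..<n}" "\<lambda>i. len (val i - thr j) + len 1" "2 * word_size ws + 4"] by simp
  also have "\<dots> \<le> word_size ws * (2 * word_size ws + 4)"
    using n_le_word_size by (rule mult_le_mono1)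
  finally have "(\<Sum>i<n. len (val i - thr j) + len 1) \<le> word_size ws * (2 * word_size ws + 4)" .
  moreover have "word_size (us j n) = len n + (\<Sum>i<n. len (val i - thr j) + len 1) + word_size cs"
    by (simp add: us_def word_size_concat_pairs)
  ultimately show ?thesis
    by (simp add: word_size_ws)
qed

end

text \<open>Every summand is at most \<open>val i\<close> whatever \<open>f\<close> contains, so the
  bound needs no correct output.\<close>

lemma (in threshold_search) len_pot_le:
  assumes "e \<le> n"
  shows "len (pot j e) \<le> 3 * word_size ws + 3 + word_size ws * (2 * word_size ws + 2)"
proof -
  define x where "x i = (if 0 < f j (Suc i) then val i - thr j else 0)" for i
  have "x i \<le> val i" for i
    by (simp add: x_def)
  then have "len (x i) \<le> 2 * word_size ws + 2" if "i < e" for i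
    using len_val_le[of i] len_mono le_trans that assms by (meson order_less_le_trans)
  then have "(\<Sum>i<e. len (x i)) \<le> e * (2 * word_size ws + 2)"
    using sum_bounded_above[of "{..<e}" "\<lambda>i. len (x i)" "2 * word_size ws + 2"] by simp
  also have "\<dots> \<le> word_size ws * (2 * word_size ws + 2)"
    using n_le_word_size assms by (intro mult_le_mono1) simp
  finally have "len (\<Sum>i<e. x i) \<le> 1 + word_size ws * (2 * word_size ws + 2)"
    using len_sum[of x e] by simp
  moreover have "len l \<le> word_size ws"
    by (simp add: word_size_ws)
  ultimately show ?thesis
    using len_add[of "l * thr j" "\<Sum>i<e. x i"] len_mult[of l "thr j"] len_thr_le[of j]
    unfolding pot_def x_def[symmetric] by simp
qed

section \<open>Rational values\<close>

text \<open>This matches the constant denominators 1 that \<open>shift_values\<close> writes with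
  the authentic code of the shifted values.\<close>

lemma rat_code_of_nat: "rat_code (of_nat m) = [m, 1]"
proof -
  have "quotient_of (of_int (int m)) = (int m, 1)"
    using quotient_of_int[of "int m"] by (simp add: Rat.of_int_def)
  then show ?thesis
    by (simp add: rat_code_def)
qed

definition numer :: "rat \<Rightarrow> nat" where
  "numer r = nat (fst (quotient_of r))"

definition denom :: "rat \<Rightarrow> nat" where
  "denom r = nat (snd (quotient_of r))"

lemma rat_code_eq: "rat_code r = [numer r, denom r]"
  by (simp add: rat_code_def numer_def denom_def split: prod.split)

lemma denom_pos: "0 < denom r"
  using quotient_of_denom_pos'[of r] by (simp add: denom_def)

lemma numer_denom: "0 \<le> r \<Longrightarrow> of_nat (numer r) = r * of_nat (denom r)"
proof -
  assume "0 \<le> r"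
  obtain a b where ab: "quotient_of r = (a, b)"
    by fastforce
  have "0 < b" "r = of_int a / of_int b"
    using quotient_of_denom_pos[OF ab] quotient_of_div[OF ab] by simp_all
  moreover have "0 \<le> a"
    using \<open>0 \<le> r\<close> calculation by (simp add: zero_le_divide_iff)
  ultimately have "of_nat (nat a) = r * of_nat (nat b)"
    by simp
  then show ?thesis
    by (simp add: numer_def denom_def ab)
qed

section \<open>The reduction\<close>

definition code_bound :: "nat \<Rightarrow> nat" where
  "code_bound w = w + w * (2 * w + 4)"

text \<open>This instantiates \<open>K\<close>: w + 2 covers the loops, and the rest is the running
  time of \<open>c\<close> on an input of size at most \<open>code_bound w\<close>.\<close>

definition step_bound :: "nat \<Rightarrow> nat \<Rightarrow> nat" where
  "step_bound k w = w + 2 + (k * code_bound w ^ k + k)"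

definition len_bound :: "nat \<Rightarrow> nat \<Rightarrow> nat" where
  "len_bound k w = step_bound k w + 3 * w + 3 + w * (2 * w + 2)"

definition time_bound :: "com \<Rightarrow> nat \<Rightarrow> nat \<Rightarrow> nat" where
  "time_bound c k w = (w + 2) * step_bound k w * (ctime (search c) * len_bound k w)"

lemma poly_bounded_time_bound: "poly_bounded (time_bound c k)"
  unfolding time_bound_def len_bound_def step_bound_def code_bound_def
  by (intro poly_bounded_intros)

lemma search_approximates:
  fixes P :: "('i, 'e) comb_problem" and \<alpha> :: real and l :: nat and v :: "'e \<Rightarrow> rat"
  assumes P: "is_comb_problem P" and "1 \<le> \<alpha>"
    and alg: "\<And>x. x \<in> inputs (min_sum_problem P) \<Longrightarrow> \<exists>t s.
        exec c (load_input (input_code (min_sum_problem P) x)) t s \<and>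
        t \<le> k * word_size (input_code (min_sum_problem P) x) ^ k + k \<and>
        (solutions (min_sum_problem P) x \<noteq> {} \<longrightarrow>
           (\<exists>S \<in> solutions (min_sum_problem P) x.
              read_output s = sol_code (min_sum_problem P) x S \<and>
              cost (min_sum_problem P) x S
                \<le> \<alpha> * Min (cost (min_sum_problem P) x ` solutions (min_sum_problem P) x)))"
    and i: "i \<in> instances P" and v: "\<forall>e \<in> set (ground P i). 0 \<le> v e"
  defines "top_cost \<equiv> \<lambda>S. real_of_rat (top_sum l (map (restrict_vec v S) (ground P i)))"
  shows "\<exists>t s. exec (search c) (load_input (l # valued_code P i v)) t s \<and>
      t \<le> time_bound c k (word_size (l # valued_code P i v)) \<and>
      (feasible P i \<noteq> {} \<longrightarrow> (\<exists>S \<in> feasible P i. read_output s = subset_code P i S \<and>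
         top_cost S \<le> \<alpha> * Min (top_cost ` feasible P i)))"
proof -
  define g where "g = ground P i"
  define n where "n = length g"
  define p where "p e = numer (v (g ! e))" for e
  define q where "q e = denom (v (g ! e))" for e
  define F where "F = feasible P i"
  have g: "distinct g" "F \<subseteq> Pow (set g)"
    using P i by (simp_all add: is_comb_problem_def g_def F_def)
  have "finite F"
    using g(2) by (rule finite_subset) simp
  have nonneg: "0 \<le> v (g ! e)" if "e < n" for e
    using v that by (simp add: g_def n_def)
  interpret scaled_instance n l p q "code P i" .
  have codes: "map (\<lambda>x. rat_code (h x)) g = map (\<lambda>e. rat_code (h (g ! e))) [0..<n]" for h
    unfolding n_def by (rule nth_equalityI) simp_all
  have ws: "ws = l # valued_code P i v"
    using codes[of v] by (simp add: ws_def valued_code_def g_def[symmetric] n_def[symmetric] rat_code_eq p_def q_def)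
  define D :: rat where "D = of_nat (den n)"
  have "0 < den n"
    by (auto simp: den_def q_def intro: prod_pos denom_pos)
  then have D: "0 < D"
    by (simp add: D_def)
  have val: "of_nat (val e) = D * v (g ! e)" if e: "e < n" for e
  proof -
    have "q e dvd den n"
      unfolding den_def using e by (intro dvd_prodI) auto
    then obtain d where d: "den n = q e * d" ..
    have "val e = p e * d"
      using d denom_pos[of "v (g ! e)"] by (simp add: val_def q_def)
    then show ?thesis
      using numer_denom[OF nonneg[OF e]] by (simp add: D_def d p_def q_def)
  qed
  \<comment> \<open>The min-sum values of round j, clipped after scaling by D so that they are
    natural numbers on the ground set.\<close>
  define u where "u j x = max 0 (D * v x - of_nat (thr j))" for j x
  have u: "u j (g ! e) = of_nat (val e - thr j)" if "e < n" for j e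
    using val[OF that] by (simp add: u_def max_def of_nat_diff)
  have us: "us j n = valued_code P i (u j)" for j
  proof -
    have "map (\<lambda>x. rat_code (u j x)) g = map (\<lambda>e. [val e - thr j, 1]) [0..<n]"
      unfolding codes[of "u j"] by (intro map_cong refl) (simp add: u rat_code_of_nat)
    then show ?thesis
      by (simp add: us_def valued_code_def g_def[symmetric] n_def[symmetric])
  qed
  define sum_cost where "sum_cost j S = real_of_rat (\<Sum>x\<in>S. u j x)" for j S
  \<comment> \<open>The claim covers every j and leaves S free when the family is empty, so that
    total functions can be chosen.\<close>
  have "\<exists>t s S. exec c (load_input (us j n)) t s \<and> t \<le> k * word_size (us j n) ^ k + k \<and>
      (F \<noteq> {} \<longrightarrow> S \<in> F \<and> read_output s = subset_code P i S \<and> sum_cost j S \<le> \<alpha> * Min (sum_cost j ` F))" for j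
  proof -
    have "(i, u j) \<in> inputs (min_sum_problem P)"
      using i by (simp add: min_sum_problem_def u_def)
    from alg[OF this] show ?thesis
      unfolding min_sum_problem_def us F_def sum_cost_def by auto
  qed
  then obtain t f Sol where c: "\<And>j. exec c (load_input (us j n)) (t j) (f j)"
      "\<And>j. t j \<le> k * word_size (us j n) ^ k + k"
    and Sol: "\<And>j. F \<noteq> {} \<Longrightarrow> Sol j \<in> F"
      "\<And>j. F \<noteq> {} \<Longrightarrow> read_output (f j) = subset_code P i (Sol j)"
      "\<And>j. F \<noteq> {} \<Longrightarrow> sum_cost j (Sol j) \<le> \<alpha> * Min (sum_cost j ` F)"
    by metis
  interpret threshold_search n l p q "code P i" f .
  define W where "W = word_size ws"
  interpret bounded_threshold_search n l p q "code P i" f c t "len_bound k W" "step_bound k W"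
  proof
    fix j
    have "word_size (us j n) ^ k \<le> code_bound W ^ k"
      unfolding code_bound_def W_def by (intro power_mono word_size_us_le) simp
    then have "k * word_size (us j n) ^ k \<le> k * code_bound W ^ k"
      by (rule mult_le_mono2)
    then show "t j \<le> step_bound k W"
      using c(2)[of j] unfolding step_bound_def by linarith
    show "exec c (load_input (us j n)) (t j) (f j)"
      by (rule c)
    show "len (pot j e) \<le> len_bound k W" if "e \<le> n" for e
      using len_pot_le[OF that, of j] by (simp add: len_bound_def W_def)
  next
    show "length ws + 2 \<le> step_bound k W"
      using length_le_word_size[of ws] by (simp add: step_bound_def W_def)
    show "step_bound k W \<le> len_bound k W"
      by (simp add: len_bound_def)
    show "len x \<le> len_bound k W" if "x \<in> set ws" for x
      using len_le_word_size[OF that] by (simp add: len_bound_def W_def)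
    show "len (den e) \<le> len_bound k W" if "e \<le> n" for e
      using len_den_le[OF that] by (simp add: len_bound_def W_def)
    show "len (val e) \<le> len_bound k W" if "e < n" for e
      using len_val_le[OF that] by (simp add: len_bound_def W_def)
  qed
  define b where "b = best (Suc n)"
  have b: "b \<le> n"
    unfolding b_def by (rule best_le_n) simp
  obtain t' s where s: "exec (search c) (load_input ws) t' s"
      "t' \<le> Suc (Suc n) * step_bound k W * (ctime (search c) * len_bound k W)"
      "read_output s = map (f b) [1..<Suc n]"
    using runs_search unfolding runs_def b_def by blast
  note s(2)
  also have "Suc (Suc n) * step_bound k W * (ctime (search c) * len_bound k W) \<le> time_bound c k W"
    unfolding time_bound_def using n_le_word_size by (intro mult_le_mono) (simp_all add: W_def)
  finally have time: "t' \<le> time_bound c k W" .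
  have "\<exists>S \<in> F. read_output s = subset_code P i S \<and> top_cost S \<le> \<alpha> * Min (top_cost ` F)" if "F \<noteq> {}"
  proof -
    \<comment> \<open>With a feasible solution present, the output of each round is a 0/1 list of
      length n, and the positivity test in \<open>pot\<close> becomes membership.\<close>
    have f: "f j 0 = n" "e < n \<Longrightarrow> f j (Suc e) = (if g ! e \<in> Sol j then 1 else 0)" for j e
    proof -
      have out: "map (f j) [1..<Suc (f j 0)] = map (\<lambda>x. if x \<in> Sol j then 1 else 0) g"
        using Sol(2)[OF that, of j] by (simp add: read_output_def subset_code_def g_def)
      from arg_cong[OF this, of length] show n: "f j 0 = n"
        by (simp add: n_def del: upt_Suc)
      show "f j (Suc e) = (if g ! e \<in> Sol j then 1 else 0)" if "e < n"
        using arg_cong[OF out, of "\<lambda>xs. xs ! e"] that n by (simp add: n_def del: upt_Suc)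
    qed
    have sub: "Sol j \<subseteq> set g" for j
      using Sol(1)[OF that] g(2) by auto
    have pot: "of_nat (pot j n) = of_nat l * of_nat (thr j) + (\<Sum>x\<in>Sol j. u j x)" for j
    proof -
      have "(\<Sum>x\<in>Sol j. u j x) = (\<Sum>x\<in>set g. if x \<in> Sol j then u j x else 0)"
        using sub[of j] by (simp add: sum.inter_restrict[symmetric] Int_absorb1)
      also have "\<dots> = (\<Sum>e<n. if g ! e \<in> Sol j then u j (g ! e) else 0)"
        using sum.reindex_bij_betw[OF bij_betw_nth[OF g(1), of "{..<n}" "set g"],
            of "\<lambda>x. if x \<in> Sol j then u j x else 0"] by (simp add: n_def)
      also have "\<dots> = (\<Sum>e<n. of_nat (if 0 < f j (Suc e) then val e - thr j else 0))"
        by (intro sum.cong) (simp_all add: u f(2))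
      finally show ?thesis
        by (simp add: pot_def)
    qed
    \<comment> \<open>Dividing by D recovers the thresholds on the original scale.\<close>
    define w where "w j = of_nat (thr j) / D" for j
    have excess: "(\<Sum>x\<in>S. max 0 (v x - w j)) = (\<Sum>x\<in>S. u j x) / D" for j S
    proof -
      have "max 0 (v x - w j) = u j x / D" for x
        using D by (simp add: u_def w_def max_def field_simps)
      then show ?thesis
        by (simp add: sum_divide_distrib)
    qed
    have sum_cost: "sum_cost j (Sol j) \<le> \<alpha> * sum_cost j S" if "S \<in> F" for j S
    proof -
      have "Min (sum_cost j ` F) \<le> sum_cost j S"
        using \<open>finite F\<close> that by simp
      then show ?thesis
        using Sol(3)[OF \<open>F \<noteq> {}\<close>, of j] \<open>1 \<le> \<alpha>\<close> mult_left_mono[of "Min (sum_cost j ` F)" "sum_cost j S" \<alpha>]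
        by linarith
    qed
    have "top_cost (Sol b) \<le> \<alpha> * top_cost S" if "S \<in> F" for S
      unfolding top_cost_def g_def[symmetric]
    proof (rule threshold_approximation[OF g _ \<open>1 \<le> \<alpha>\<close>, where w = w and n = n])
      show "insert 0 (v ` set g) \<subseteq> w ` {..n}"
      proof -
        have "w n = 0" "\<And>e. e < n \<Longrightarrow> w e = v (g ! e)"
          using D val by (simp_all add: w_def thr_def)
        then show ?thesis
          by (auto simp: in_set_conv_nth n_def image_iff) (metis atMost_iff less_imp_le order_refl)+
      qed
      \<comment> \<open>This is the min-sum guarantee with both sides divided by D.\<close>
      show "\<forall>j\<le>n. \<forall>S\<in>F. real_of_rat (\<Sum>x\<in>Sol j. max 0 (v x - w j))
          \<le> \<alpha> * real_of_rat (\<Sum>x\<in>S. max 0 (v x - w j))"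
        using sum_cost D unfolding excess sum_cost_def by (simp add: of_rat_divide divide_right_mono)
      show "\<forall>j\<le>n. of_nat l * w b + (\<Sum>x\<in>Sol b. max 0 (v x - w b))
          \<le> of_nat l * w j + (\<Sum>x\<in>Sol j. max 0 (v x - w j))"
      proof (intro allI impI)
        fix j assume "j \<le> n"
        then have "rat_of_nat (pot b n) / D \<le> rat_of_nat (pot j n) / D"
          using pot_best_le[of j "Suc n"] D by (simp add: b_def divide_right_mono del: best.simps)
        then show "of_nat l * w b + (\<Sum>x\<in>Sol b. max 0 (v x - w b))
            \<le> of_nat l * w j + (\<Sum>x\<in>Sol j. max 0 (v x - w j))"
          unfolding pot excess unfolding w_def by (simp add: add_divide_distrib)
      qed
    qed (use v D b Sol(1) \<open>F \<noteq> {}\<close> that in \<open>simp_all add: g_def w_def\<close>)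
    moreover have "Min (top_cost ` F) \<in> top_cost ` F"
      using \<open>finite F\<close> \<open>F \<noteq> {}\<close> by simp
    ultimately have "top_cost (Sol b) \<le> \<alpha> * Min (top_cost ` F)"
      by auto
    \<comment> \<open>The program copies n cells, and \<open>f b 0 = n\<close> says that this is the
      output length of the chosen run.\<close>
    moreover have "read_output s = subset_code P i (Sol b)"
      using s(3) f(1)[of b] Sol(2)[OF that, of b] by (simp add: read_output_def)
    ultimately show ?thesis
      using Sol(1)[OF that] by blast
  qed
  then show ?thesis
    using s(1) time unfolding ws W_def F_def by blast
qed

theorem theoremB2:
  fixes P :: "('i, 'e) comb_problem" and \<alpha> :: real
  assumes "is_comb_problem P"
    and "\<alpha> \<ge> 1"
    and "polytime_approximable \<alpha> (min_sum_problem P)"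
  shows "polytime_approximable \<alpha> (top_min_problem P)"
proof -
  obtain c k where alg: "\<And>x. x \<in> inputs (min_sum_problem P) \<Longrightarrow> \<exists>t s.
        exec c (load_input (input_code (min_sum_problem P) x)) t s \<and>
        t \<le> k * word_size (input_code (min_sum_problem P) x) ^ k + k \<and>
        (solutions (min_sum_problem P) x \<noteq> {} \<longrightarrow>
           (\<exists>S \<in> solutions (min_sum_problem P) x.
              read_output s = sol_code (min_sum_problem P) x S \<and>
              cost (min_sum_problem P) x S
                \<le> \<alpha> * Min (cost (min_sum_problem P) x ` solutions (min_sum_problem P) x)))"
    using assms(3) unfolding polytime_approximable_def polytime_approx_algorithm_def by blast
  obtain k' where k': "\<And>w. 2 \<le> w \<Longrightarrow> time_bound c k w \<le> k' * w ^ k' + k'"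
    using poly_boundedD[OF poly_bounded_time_bound] by blast
  have "\<exists>t s. exec (search c) (load_input (l # valued_code P i v)) t s \<and>
      t \<le> k' * word_size (l # valued_code P i v) ^ k' + k' \<and>
      (feasible P i \<noteq> {} \<longrightarrow> (\<exists>S \<in> feasible P i. read_output s = subset_code P i S \<and>
         real_of_rat (top_sum l (map (restrict_vec v S) (ground P i))) \<le>
         \<alpha> * Min ((\<lambda>S. real_of_rat (top_sum l (map (restrict_vec v S) (ground P i)))) ` feasible P i)))"
    if "i \<in> instances P" "\<forall>e \<in> set (ground P i). 0 \<le> v e" for i l v
  proof -
    \<comment> \<open>The entries l and n alone bring the input size into the range where the
      polynomial bound holds.\<close>
    have "2 \<le> length (l # valued_code P i v)"
      by (simp add: valued_code_def)
    then have "2 \<le> word_size (l # valued_code P i v)"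
      using length_le_word_size le_trans by blast
    from k'[OF this] show ?thesis
      using search_approximates[OF assms(1,2) alg that, of l] le_trans by blast
  qed
  then have "polytime_approx_algorithm \<alpha> (top_min_problem P) (search c)"
    unfolding polytime_approx_algorithm_def top_min_problem_def
    by (intro exI[of _ k']) auto
  then show ?thesis
    unfolding polytime_approximable_def by blast
qed

end
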